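(* Let $\Omega\subset\mathbb{R}^n$ be a convex domain and let $u:\Omega\to\mathbb{R}$ be convex and of class $C^2$ in $\Omega$. Then, for every $x\in\Omega$, $$u(x)=\inf_{\substack{\det A=1\\ E_\varepsilon(A,x)\subset\Omega}}\left\{\frac{1}{|B_\varepsilon(0)|}\int_{B_\varepsilon(0)}u(x+Ay)\,dy\right\}-\frac{n}{2(n+2)}\left(\det D^2u(x)\right)^{1/n}\varepsilon^2+o(\varepsilon^2)\qquad\text{as }\varepsilon\to0,$$ where the infimum is over symmetric positive definite $n\times n$ real matrices $A$ satisfying the stated constraints.
   Context: $B_\varepsilon(0)=\{y\in\mathbb{R}^n:|y|\le\varepsilon\}$. For a matrix $A$ with $\det A=1$, $x\in\mathbb{R}^n$ and $\varepsilon>0$, the ellipsoid $E_\varepsilon(A,x)$ is $$E_\varepsilon(A,x)=\{y\in\mathbb{R}^n:|A^{-1}(y-x)|\le\varepsilon\}=\{x+Ay:y\in B_\varepsilon(0)\}.$$ The expansion is pointwise in $x$ (no uniformity in $x$ is claimed). *)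

theory Defs
  imports "HOL-Analysis.Analysis" "HOL-Library.Landau_Symbols"
begin

(* Where f is not differentiable (resp. gradient f is not differentiable), frechet_derivative is
   arbitrary; C2_on below includes the differentiability that makes these meaningful. *)
definition gradient :: "(real^'n \<Rightarrow> real) \<Rightarrow> real^'n \<Rightarrow> real^'n" where
  "gradient f x = (\<chi> i. frechet_derivative f (at x) (axis i 1))"

definition hessian :: "(real^'n \<Rightarrow> real) \<Rightarrow> real^'n \<Rightarrow> real^'n^'n" where
  "hessian f x = jacobian (gradient f) (at x)"

(* Intended for open S: derivatives are taken in the full neighbourhood filter at x. *)
definition C2_on :: "(real^'n \<Rightarrow> real) \<Rightarrow> (real^'n) set \<Rightarrow> bool" where
  "C2_on f S \<longleftrightarrow>
     (\<forall>x\<in>S. f differentiable (at x)) \<and>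
     (\<forall>x\<in>S. gradient f differentiable (at x)) \<and>
     continuous_on S (hessian f)"

definition sym_pos_def :: "real^'n^'n \<Rightarrow> bool" where
  "sym_pos_def A \<longleftrightarrow> transpose A = A \<and> (\<forall>v. v \<noteq> 0 \<longrightarrow> v \<bullet> (A *v v) > 0)"

definition ellipsoid :: "real \<Rightarrow> real^'n^'n \<Rightarrow> real^'n \<Rightarrow> (real^'n) set" where
  "ellipsoid \<epsilon> A x = {y. norm (matrix_inv A *v (y - x)) \<le> \<epsilon>}"

lemma ellipsoid_eq_image:
  fixes A :: "real^'n^'n"
  assumes "det A = 1"
  shows "ellipsoid \<epsilon> A x = (\<lambda>y. x + A *v y) ` cball 0 \<epsilon>"
proof -
  have "invertible A"
    using assms by (simp add: invertible_det_nz)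
  then have "A ** matrix_inv A = mat 1 \<and> matrix_inv A ** A = mat 1"
    unfolding invertible_def matrix_inv_def by (rule someI_ex)
  then have inv: "A ** matrix_inv A = mat 1" "matrix_inv A ** A = mat 1"
    by simp_all
  show ?thesis
  proof (intro equalityI subsetI)
    fix y assume "y \<in> ellipsoid \<epsilon> A x"
    moreover have "y = x + A *v (matrix_inv A *v (y - x))"
      by (simp add: matrix_vector_mul_assoc inv)
    ultimately show "y \<in> (\<lambda>y. x + A *v y) ` cball 0 \<epsilon>"
      unfolding ellipsoid_def by (intro image_eqI) auto
  next
    fix y assume "y \<in> (\<lambda>y. x + A *v y) ` cball 0 \<epsilon>"
    then show "y \<in> ellipsoid \<epsilon> A x"
      by (auto simp: ellipsoid_def matrix_vector_mul_assoc inv)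
  qed
qed

definition admissible :: "(real^'n) set \<Rightarrow> real \<Rightarrow> real^'n \<Rightarrow> (real^'n^'n) set" where
  "admissible \<Omega> \<epsilon> x = {A. sym_pos_def A \<and> det A = 1 \<and> ellipsoid \<epsilon> A x \<subseteq> \<Omega>}"

definition ellipsoid_mean :: "(real^'n \<Rightarrow> real) \<Rightarrow> real \<Rightarrow> real^'n^'n \<Rightarrow> real^'n \<Rightarrow> real" where
  "ellipsoid_mean u \<epsilon> A x =
     (1 / measure lborel (cball (0::real^'n) \<epsilon>)) * (LINT y:cball 0 \<epsilon>|lborel. u (x + A *v y))"

end

theory Submission
  imports Defs
begin

text \<open>Let \<open>H\<close> be the Hessian of \<open>u\<close> at \<open>x\<close>. Averaging the symmetric difference
  \<open>(u (x + h) + u (x - h)) / 2 - u x\<close>, which is \<open>(h \<bullet> H h) / 2 + o(|h|\<^sup>2)\<close>, over \<open>h = A y\<close> gives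
  \<open>\<epsilon>\<^sup>2 / (2 (n + 2)) * trace (A H A)\<close> up to the error term, and over symmetric positive definite \<open>A\<close>
  of determinant one the infimum of \<open>trace (A H A)\<close> is \<open>n * (det H) powr (1 / n)\<close> by AM-GM for
  the eigenvalues. A fixed almost optimal \<open>A\<close> gives the upper bound.

  For the lower bound, very eccentric ellipsoids leave the region where the expansion is valid.
  If \<open>det H = 0\<close>, then \<open>u x\<close> is a sufficient lower bound by convexity. Otherwise, when
  \<open>t = |A| \<epsilon> / r > 1\<close>, where \<open>|A|\<close> is the Frobenius norm and \<open>r\<close> the radius up to which the
  expansion is used, convexity along rays bounds the symmetric difference at \<open>h\<close> below by \<open>t\<close>
  times its value at \<open>h / t\<close>; since \<open>H\<close> is coercive, the resulting mean exceeds \<open>u x\<close> by a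
  constant independent of \<open>\<epsilon>\<close>.\<close>

section \<open>Symmetric matrices\<close>

definition diag_mat :: "('n \<Rightarrow> real) \<Rightarrow> real^'n^'n" where
  "diag_mat d = (\<chi> i j. if i = j then d i else 0)"

lemma diag_mat_vec [simp]: "(diag_mat d *v v) $ i = d i * v $ i"
  by (simp add: diag_mat_def matrix_vector_mult_def if_distrib if_distribR sum.delta cong: if_cong)

lemma diag_mat_mult: "diag_mat a ** diag_mat b = diag_mat (\<lambda>i. a i * b i)"
proof -
  have "(\<Sum>k\<in>UNIV. (if i = k then a i else 0) * (if k = j then b k else 0)) = (if i = j then a i * b i else 0)"
    for i j
    by (subst sum.remove[of _ i]) (auto intro!: sum.neutral)
  then show ?thesis
    by (simp add: diag_mat_def matrix_matrix_mult_def vec_eq_iff)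
qed

lemma transpose_diag_mat [simp]: "transpose (diag_mat d) = diag_mat d"
  by (simp add: diag_mat_def transpose_def vec_eq_iff)

lemma det_diag_mat [simp]: "det (diag_mat d) = prod d UNIV"
  by (subst det_diagonal) (simp_all add: diag_mat_def)

lemma trace_diag_mat [simp]: "trace (diag_mat d) = sum d UNIV"
  by (simp add: diag_mat_def trace_def)

lemma symmetric_matrix_inner:
  fixes M :: "real^'n^'n"
  assumes "transpose M = M"
  shows "(M *v v) \<bullet> w = v \<bullet> (M *v w)"
  by (metis assms dot_lmul_matrix transpose_matrix_vector)

text \<open>Rayleigh quotient: a maximiser \<open>v\<close> of \<open>w \<bullet> (M *v w)\<close>
  on the unit sphere of \<open>W\<close> is an eigenvector, and the maximum is its eigenvalue. The
  first-order condition is obtained by perturbing \<open>v\<close> inside \<open>W\<close>.\<close>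

lemma symmetric_matrix_eigenvector:
  fixes M :: "real^'n^'n"
  assumes sym: "transpose M = M" and W: "subspace W" "W \<noteq> {0}"
    and inv: "\<And>w. w \<in> W \<Longrightarrow> M *v w \<in> W"
  obtains v l where "v \<in> W" "norm v = 1" "M *v v = l *\<^sub>R v"
proof -
  define S where "S = sphere 0 1 \<inter> W"
  have "compact S"
    unfolding S_def by (rule compact_Int_closed[OF compact_sphere closed_subspace[OF W(1)]])
  moreover have "S \<noteq> {}"
  proof -
    obtain w where "w \<in> W" "w \<noteq> 0" using W subspace_0 by blast
    then have "w /\<^sub>R norm w \<in> S" by (auto simp: S_def W(1) subspace_scale)
    then show ?thesis by blast
  qed
  moreover have "continuous_on S (\<lambda>w. w \<bullet> (M *v w))"
    by (rule continuous_on_inner[OF continuous_on_id linear_continuous_on[OF matrix_vector_mul_bounded_linear]])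
  ultimately have "\<exists>v\<in>S. \<forall>w\<in>S. w \<bullet> (M *v w) \<le> v \<bullet> (M *v v)"
    by (rule continuous_attains_sup)
  then obtain v where v: "v \<in> S" and max: "\<And>w. w \<in> S \<Longrightarrow> w \<bullet> (M *v w) \<le> v \<bullet> (M *v v)"
    by blast
  define l where "l = v \<bullet> (M *v v)"
  have vW: "v \<in> W" and v1: "norm v = 1" using v by (auto simp: S_def)
  have vv: "v \<bullet> v = 1" using v1 by (simp add: norm_eq_1)
  have bound: "w \<bullet> (M *v w) \<le> l * (w \<bullet> w)" if "w \<in> W" for w
  proof (cases "w = 0")
    case False
    have "w /\<^sub>R norm w \<in> S" using that False by (auto simp: S_def W(1) subspace_scale)
    from max[OF this] have "(w \<bullet> (M *v w)) / (norm w * norm w) \<le> l"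
      by (simp add: matrix_vector_mult_scaleR l_def divide_inverse mult_ac)
    moreover have "norm w * norm w = w \<bullet> w"
      by (simp add: norm_eq_sqrt_inner)
    moreover have "w \<bullet> w > 0" using False by simp
    ultimately show ?thesis by (simp add: divide_le_eq)
  qed auto
  \<comment> \<open>The residual lies in \<open>W\<close> by invariance, so the maximum can be
    tested at \<open>v + t *\<^sub>R z\<close>. The gain is linear in \<open>t\<close> with
    coefficient \<open>2 * (z \<bullet> z)\<close>, the loss is quadratic.\<close>
  define z where "z = M *v v - l *\<^sub>R v"
  have zW: "z \<in> W" unfolding z_def by (intro subspace_diff subspace_scale W inv vW)
  define q where "q = l * (z \<bullet> z) - z \<bullet> (M *v z)"
  have ineq: "2 * t * (z \<bullet> z) \<le> t\<^sup>2 * q" for t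
  proof -
    have "v + t *\<^sub>R z \<in> W" by (intro subspace_add subspace_scale W vW zW)
    from bound[OF this]
    have "l + 2 * t * (z \<bullet> (M *v v)) + t\<^sup>2 * (z \<bullet> (M *v z)) \<le> l + 2 * t * l * (z \<bullet> v) + t\<^sup>2 * l * (z \<bullet> z)"
      using symmetric_matrix_inner[OF sym, of v z] vv
      by (simp add: matrix_vector_mult_scaleR matrix_vector_right_distrib inner_add_left inner_add_right
          l_def[symmetric] inner_commute algebra_simps power2_eq_square)
    moreover have "z \<bullet> (M *v v) = z \<bullet> z + l * (z \<bullet> v)"
      by (simp add: z_def inner_diff_right inner_diff_left)
    ultimately show ?thesis by (simp add: q_def algebra_simps)
  qed
  have "z \<bullet> z \<le> 0"
  proof (rule ccontr)
    assume "\<not> z \<bullet> z \<le> 0"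
    then have p: "z \<bullet> z > 0" by linarith
    \<comment> \<open>A step so small that the quadratic loss cannot offset the linear gain;
      \<open>+ 1\<close> covers \<open>q = 0\<close>.\<close>
    define t where "t = (z \<bullet> z) / (\<bar>q\<bar> + 1)"
    have t: "t > 0" using p by (simp add: t_def)
    have "t * \<bar>q\<bar> < z \<bullet> z" using p by (simp add: t_def divide_less_eq field_simps)
    then have "t * q < 2 * (z \<bullet> z)" using t p by (smt (verit) mult_left_mono)
    then have "t\<^sup>2 * q < 2 * t * (z \<bullet> z)" using t by (simp add: power2_eq_square)
    with ineq[of t] show False by simp
  qed
  then have "z = 0" by (meson inner_gt_zero_iff not_less)
  then have "M *v v = l *\<^sub>R v" by (simp add: z_def)
  with that vW v1 show ?thesis by blast
qed

text \<open>A maximal orthonormal set of eigenvectors spans, as its orthogonal complement is invariant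
  and would otherwise contain a further eigenvector.\<close>
lemma spectral_theorem_symmetric_matrix:
  fixes M :: "real^'n^'n"
  assumes sym: "transpose M = M"
  obtains P d where "orthogonal_matrix P" "M = P ** diag_mat d ** transpose P"
proof -
  define E where "E B \<longleftrightarrow> pairwise orthogonal B \<and> (\<forall>b\<in>B. norm b = 1 \<and> (\<exists>l. M *v b = l *\<^sub>R b))" for B
  have indep: "independent B" if "E B" for B
    using that unfolding E_def by (intro pairwise_orthogonal_independent) force+
  have fin: "finite B" "card B \<le> CARD('n)" if "E B" for B
    using indep[OF that] independent_bound[of B] by auto
  have "E {}" by (simp add: E_def)
  then obtain B where B: "E B" and Bmax: "\<And>C. E C \<Longrightarrow> card C \<le> card B"
    using ex_has_greatest_nat[of E "{}" card "Suc CARD('n)"] fin(2) by (metis less_Suc_eq_le)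
  define W where "W = {w. \<forall>b\<in>B. b \<bullet> w = 0}"
  have W: "subspace W"
    by (auto simp: W_def subspace_def inner_add_right)
  have Winv: "M *v w \<in> W" if "w \<in> W" for w
  proof -
    have "b \<bullet> (M *v w) = 0" if b: "b \<in> B" for b
    proof -
      obtain l where "M *v b = l *\<^sub>R b" using B b unfolding E_def by blast
      then show ?thesis using symmetric_matrix_inner[OF sym, of b w] \<open>w \<in> W\<close> b by (simp add: W_def)
    qed
    then show ?thesis by (simp add: W_def)
  qed
  have "W = {0}"
  proof (rule ccontr)
    assume "W \<noteq> {0}"
    then obtain v l where v: "v \<in> W" "norm v = 1" "M *v v = l *\<^sub>R v"
      using symmetric_matrix_eigenvector[OF sym W _ Winv] by blast
    have "v \<notin> B" using v by (auto simp: W_def)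
    have "E (insert v B)"
      using B v by (auto simp: E_def W_def pairwise_insert orthogonal_def inner_commute)
    then have "card (insert v B) \<le> card B" by (rule Bmax)
    then show False using \<open>v \<notin> B\<close> fin(1)[OF B] by simp
  qed
  have "span B = UNIV"
  proof (rule ccontr)
    assume "span B \<noteq> UNIV"
    then obtain a where "a \<noteq> 0" "\<And>x. x \<in> span B \<Longrightarrow> a \<bullet> x = 0"
      using span_not_univ_subset_hyperplane by blast
    then have "a \<in> W" by (auto simp: W_def inner_commute span_base)
    then show False using \<open>W = {0}\<close> \<open>a \<noteq> 0\<close> by blast
  qed
  then have "card B = CARD('n)"
    using indep[OF B] by (metis DIM_cart DIM_real dim_UNIV dim_eq_card_independent dim_span mult.right_neutral)
  then obtain f where f: "bij_betw f (UNIV::'n set) B"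
    by (metis fin(1)[OF B] finite_class.finite_UNIV finite_same_card_bij)
  define P :: "real^'n^'n" where "P = (\<chi> i j. f j $ i)"
  have col: "column j P = f j" for j by (simp add: P_def column_def vec_eq_iff)
  have fB: "f j \<in> B" for j using f by (auto simp: bij_betw_def)
  have oP: "orthogonal_matrix P"
    unfolding orthogonal_matrix_orthonormal_columns col
    using B f fB unfolding E_def pairwise_def bij_betw_def inj_on_def by (metis UNIV_I)
  have "\<forall>j. \<exists>l. M *v f j = l *\<^sub>R f j" using B fB unfolding E_def by blast
  then obtain d where d: "\<And>j. M *v f j = d j *\<^sub>R f j" by metis
  \<comment> \<open>Column by column this is the eigenvalue equation for \<open>f j\<close>.\<close>
  have "M ** P = P ** diag_mat d"
  proof -
    have "(M ** P) $ i $ j = (P ** diag_mat d) $ i $ j" for i j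
    proof -
      have "(M ** P) $ i $ j = (M *v f j) $ i"
        by (simp add: P_def matrix_matrix_mult_def matrix_vector_mult_def)
      also have "\<dots> = f j $ i * d j" by (simp add: d)
      also have "\<dots> = (P ** diag_mat d) $ i $ j"
        by (simp add: P_def matrix_matrix_mult_def diag_mat_def if_distrib cong: if_cong)
      finally show ?thesis .
    qed
    then show ?thesis by (simp add: vec_eq_iff)
  qed
  then have "M = P ** diag_mat d ** transpose P"
    using oP by (metis matrix_mul_assoc matrix_mul_rid orthogonal_matrix_def)
  with that oP show ?thesis by blast
qed

section \<open>Trace, determinant and quadratic form under orthogonal conjugation\<close>

lemma orthogonal_conj_mult:
  fixes P :: "real^'n^'n"
  assumes "orthogonal_matrix P"
  shows "(P ** X ** transpose P) ** (P ** Y ** transpose P) = P ** (X ** Y) ** transpose P"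
  using assms by (metis matrix_mul_assoc matrix_mul_lid orthogonal_matrix)

lemma trace_orthogonal_conj:
  fixes P :: "real^'n^'n"
  assumes "orthogonal_matrix P"
  shows "trace (P ** X ** transpose P) = trace X"
  using assms by (metis matrix_mul_assoc matrix_mul_lid orthogonal_matrix trace_mul_sym)

lemma det_orthogonal_conj:
  fixes P :: "real^'n^'n"
  assumes "orthogonal_matrix P"
  shows "det (P ** X ** transpose P) = det X"
proof -
  have "det P * det P = 1"
    using det_orthogonal_matrix[OF assms] by auto
  then show ?thesis by (simp add: det_mul det_transpose mult.commute mult.left_commute)
qed

lemma inner_orthogonal_conj_diag:
  fixes P :: "real^'n^'n"
  shows "v \<bullet> ((P ** diag_mat d ** transpose P) *v v) = (\<Sum>i\<in>UNIV. d i * ((transpose P *v v) $ i)\<^sup>2)"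
proof -
  have "v \<bullet> ((P ** diag_mat d ** transpose P) *v v) = v \<bullet> (P *v (diag_mat d *v (transpose P *v v)))"
    by (simp only: matrix_vector_mul_assoc matrix_mul_assoc)
  also have "\<dots> = (transpose P *v v) \<bullet> (diag_mat d *v (transpose P *v v))"
    by (simp add: dot_lmul_matrix)
  also have "\<dots> = (\<Sum>i\<in>UNIV. d i * ((transpose P *v v) $ i)\<^sup>2)"
    unfolding inner_vec_def by (simp add: power2_eq_square algebra_simps)
  finally show ?thesis .
qed

text \<open>Testing the form on the \<open>i\<close>-th column of \<open>P\<close>, an eigenvector,
  isolates \<open>d i\<close>.\<close>

lemma psd_diag_nonneg:
  fixes P :: "real^'n^'n"
  assumes "orthogonal_matrix P" and psd: "\<And>v. 0 \<le> v \<bullet> ((P ** diag_mat d ** transpose P) *v v)"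
  shows "0 \<le> d i"
proof -
  have "transpose P *v (P *v axis i 1) = axis i 1"
    using assms(1) by (simp add: matrix_vector_mul_assoc orthogonal_matrix del: transpose_matrix_vector)
  then have "0 \<le> (\<Sum>j\<in>UNIV. d j * (axis i 1 $ j)\<^sup>2)"
    using psd[of "P *v axis i 1"] by (simp add: inner_orthogonal_conj_diag del: transpose_matrix_vector)
  also have "(\<lambda>j. d j * (axis i 1 $ j)\<^sup>2) = (\<lambda>j. if j = i then d i else 0)"
    by (auto simp: axis_def fun_eq_iff)
  also have "sum \<dots> UNIV = d i" by simp
  finally show ?thesis .
qed

text \<open>AM-GM for the eigenvalues, since trace and determinant are invariant under orthogonal
  conjugation. Applied to \<open>A ** H ** A\<close> with \<open>det A = 1\<close>, it bounds the
  second-order term from below independently of \<open>A\<close>.\<close>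

lemma det_powr_le_trace:
  fixes M :: "real^'n^'n"
  assumes "transpose M = M" and "\<And>v. 0 \<le> v \<bullet> (M *v v)"
  shows "real CARD('n) * det M powr (1 / real CARD('n)) \<le> trace M"
proof -
  obtain P d where P: "orthogonal_matrix P" and M: "M = P ** diag_mat d ** transpose P"
    using spectral_theorem_symmetric_matrix[OF assms(1)] .
  have "0 \<le> d i" for i using psd_diag_nonneg[OF P] assms(2) M by blast
  then have "prod d UNIV powr (1 / real CARD('n)) \<le> (\<Sum>i\<in>UNIV. d i / real CARD('n))"
    by (intro arith_geom_mean) auto
  then have "real CARD('n) * prod d UNIV powr (1 / real CARD('n)) \<le> sum d UNIV"
    by (simp add: sum_divide_distrib[symmetric] field_simps)
  then show ?thesis by (simp add: M det_orthogonal_conj[OF P] trace_orthogonal_conj[OF P])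
qed

text \<open>The eigenvalues are nonnegative with nonzero product, hence all positive; the smallest
  one serves as \<open>c\<close>.\<close>

lemma psd_det_nonzero_coercive:
  fixes M :: "real^'n^'n"
  assumes "transpose M = M" and "\<And>v. 0 \<le> v \<bullet> (M *v v)" and "det M \<noteq> 0"
  obtains c where "c > 0" "\<And>v. c * (norm v)\<^sup>2 \<le> v \<bullet> (M *v v)"
proof -
  obtain P d where P: "orthogonal_matrix P" and M: "M = P ** diag_mat d ** transpose P"
    using spectral_theorem_symmetric_matrix[OF assms(1)] .
  have nonneg: "0 \<le> d i" for i using psd_diag_nonneg[OF P] assms(2) M by blast
  have "prod d UNIV \<noteq> 0" using assms(3) by (simp add: M det_orthogonal_conj[OF P])
  then have pos: "0 < d i" for i using nonneg[of i] by (simp add: less_le prod_zero_iff)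
  define c where "c = Min (range d)"
  have cd: "c \<le> d i" for i unfolding c_def by (rule Min_le) auto
  have "c > 0" unfolding c_def using pos by (subst Min_gr_iff) auto
  moreover have "c * (norm v)\<^sup>2 \<le> v \<bullet> (M *v v)" for v
  proof -
    define w where "w = transpose P *v v"
    have "norm w = norm v"
    proof -
      have "w \<bullet> w = v \<bullet> (P *v (transpose P *v v))" by (simp add: w_def dot_lmul_matrix)
      also have "\<dots> = v \<bullet> v"
        using P by (simp add: matrix_vector_mul_assoc orthogonal_matrix_def del: transpose_matrix_vector)
      finally show ?thesis by (simp add: norm_eq)
    qed
    then have "c * (norm v)\<^sup>2 = c * (w \<bullet> w)" by (simp add: power2_norm_eq_inner[symmetric])
    also have "\<dots> = (\<Sum>i\<in>UNIV. c * (w $ i)\<^sup>2)"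
      by (simp add: inner_vec_def power2_eq_square sum_distrib_left)
    also have "\<dots> \<le> (\<Sum>i\<in>UNIV. d i * (w $ i)\<^sup>2)" by (intro sum_mono mult_right_mono cd) auto
    also have "\<dots> = v \<bullet> (M *v v)" unfolding M inner_orthogonal_conj_diag w_def ..
    finally show ?thesis .
  qed
  ultimately show ?thesis using that by blast
qed

text \<open>The optimal matrix is \<open>(det M) powr (1/(2n))\<close> times \<open>M powr (-1/2)\<close>; when \<open>M\<close> is singular the
  infimum is not attained, so \<open>M\<close> is replaced by \<open>M + \<eta> I\<close>.\<close>
lemma exists_sym_pos_def_trace_le:
  fixes M :: "real^'n^'n"
  assumes "transpose M = M" and "\<And>v. 0 \<le> v \<bullet> (M *v v)" and "\<delta> > 0"
  obtains A where "sym_pos_def A" "det A = 1"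
    "trace (A ** M ** A) \<le> real CARD('n) * det M powr (1 / real CARD('n)) + \<delta>"
proof -
  let ?n = "real CARD('n)"
  obtain P d where P: "orthogonal_matrix P" and M: "M = P ** diag_mat d ** transpose P"
    using spectral_theorem_symmetric_matrix[OF assms(1)] .
  have nonneg: "0 \<le> d i" for i using psd_diag_nonneg[OF P] assms(2) M by blast
  \<comment> \<open>The \<open>n\<close>-th root of the determinant of \<open>M\<close> shifted by
    \<eta> times the identity.\<close>
  define G where "G \<eta> = (\<Prod>i\<in>UNIV. d i + \<eta>) powr (1 / ?n)" for \<eta>
  have ev: "eventually (\<lambda>\<eta>. \<eta> > (0::real)) (at_right 0)" by (simp add: eventually_at_right_less)
  \<comment> \<open>The base of the power may tend to 0 if \<open>M\<close> is singular; the limit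
    still holds because the exponent is positive and the base nonnegative.\<close>
  have "((\<lambda>\<eta>. ?n * G \<eta>) \<longlongrightarrow> ?n * (\<Prod>i\<in>UNIV. d i + 0) powr (1 / ?n)) (at_right 0)"
    unfolding G_def
    by (intro tendsto_intros disjI2 conjI eventually_mono[OF ev] prod_nonneg)
       (use nonneg in \<open>auto intro: add_nonneg_nonneg less_imp_le\<close>)
  then have "eventually (\<lambda>\<eta>. ?n * G \<eta> < ?n * (\<Prod>i\<in>UNIV. d i + 0) powr (1 / ?n) + \<delta>) (at_right 0)"
    by (rule order_tendstoD) (use assms(3) in simp)
  then obtain \<eta> where \<eta>: "\<eta> > 0" and less: "?n * G \<eta> < ?n * prod d UNIV powr (1 / ?n) + \<delta>"
    using eventually_happens[OF eventually_conj[OF ev]] by auto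
  define \<mu> where "\<mu> i = d i + \<eta>" for i
  have \<mu>: "\<mu> i > 0" for i using nonneg[of i] \<eta> by (simp add: \<mu>_def)
  have prod\<mu>: "prod \<mu> UNIV > 0" by (simp add: prod_pos \<mu>)
  then have Gpos: "G \<eta> > 0" unfolding G_def \<mu>_def[symmetric] using less_imp_neq powr_gt_zero by metis
  \<comment> \<open>Equality case of AM-GM for the shifted matrix: every
    \<open>a i * \<mu> i * a i\<close> equals \<open>G \<eta>\<close>, and the product of the
    squares of the \<open>a i\<close> is 1.\<close>
  define a where "a i = sqrt (G \<eta> / \<mu> i)" for i
  have apos: "a i > 0" for i using Gpos \<mu>[of i] by (simp add: a_def)
  have asq: "a i * a i = G \<eta> / \<mu> i" for i using Gpos \<mu>[of i] by (simp add: a_def)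
  define A where "A = P ** diag_mat a ** transpose P"
  have tA: "transpose A = A"
    by (simp add: A_def matrix_transpose_mul matrix_mul_assoc)
  have "sym_pos_def A"
    unfolding sym_pos_def_def
  proof (intro conjI allI impI tA)
    fix v :: "real^'n" assume "v \<noteq> 0"
    define w where "w = transpose P *v v"
    have "P *v w = v"
      using P by (simp add: w_def matrix_vector_mul_assoc orthogonal_matrix_def del: transpose_matrix_vector)
    then have "w \<noteq> 0" using \<open>v \<noteq> 0\<close> by auto
    then obtain i where "w $ i \<noteq> 0" by (auto simp: vec_eq_iff)
    then have "0 < (\<Sum>i\<in>UNIV. a i * (w $ i)\<^sup>2)"
      using apos by (intro sum_pos2[where i = i]) (auto intro!: mult_nonneg_nonneg less_imp_le[OF apos])
    then show "0 < v \<bullet> (A *v v)" unfolding A_def inner_orthogonal_conj_diag w_def .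
  qed
  moreover have "det A = 1"
  proof -
    have "(\<Prod>i\<in>UNIV. a i)\<^sup>2 = (\<Prod>i\<in>UNIV. a i * a i)" by (simp add: power2_eq_square prod.distrib)
    also have "\<dots> = G \<eta> ^ CARD('n) / prod \<mu> UNIV" by (simp add: asq prod_dividef)
    also have "G \<eta> ^ CARD('n) = prod \<mu> UNIV"
      using prod\<mu> Gpos by (simp add: G_def \<mu>_def[symmetric] powr_powr flip: powr_realpow)
    also have "prod \<mu> UNIV / prod \<mu> UNIV = 1" using less_imp_neq[OF prod\<mu>] divide_self by metis
    finally have "(prod a UNIV)\<^sup>2 = 1" .
    moreover have "prod a UNIV > 0" by (simp add: prod_pos apos)
    ultimately have "prod a UNIV = 1" by (simp add: power2_eq_1_iff)
    then show ?thesis by (simp add: A_def det_orthogonal_conj[OF P])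
  qed
  moreover have "trace (A ** M ** A) \<le> ?n * det M powr (1 / ?n) + \<delta>"
  proof -
    have "A ** M ** A = P ** diag_mat (\<lambda>i. a i * d i * a i) ** transpose P"
      by (simp add: A_def M orthogonal_conj_mult[OF P] diag_mat_mult)
    then have "trace (A ** M ** A) = (\<Sum>i\<in>UNIV. a i * d i * a i)"
      by (simp add: trace_orthogonal_conj[OF P])
    also have "\<dots> \<le> (\<Sum>i\<in>(UNIV::'n set). G \<eta>)"
    \<comment> \<open>Returning from \<open>\<mu> i\<close> to the smaller \<open>d i\<close> can
      only decrease each summand.\<close>
    proof (rule sum_mono)
      fix i
      have "a i * d i * a i = (a i * a i) * d i" by (simp only: mult_ac)
      also have "\<dots> = G \<eta> * (d i / \<mu> i)" unfolding asq by simp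
      also have "\<dots> \<le> G \<eta> * 1"
        using Gpos \<mu>[of i] \<eta> by (intro mult_left_mono) (auto simp: \<mu>_def divide_le_eq)
      finally show "a i * d i * a i \<le> G \<eta>" by simp
    qed
    also have "\<dots> \<le> ?n * prod d UNIV powr (1 / ?n) + \<delta>" using less by simp
    finally show ?thesis by (simp add: M det_orthogonal_conj[OF P])
  qed
  ultimately show ?thesis using that by blast
qed

section \<open>Second moments of a ball\<close>

lemma set_integrable_cball_continuous:
  fixes f :: "'a::euclidean_space \<Rightarrow> real"
  assumes "continuous_on (cball a r) f"
  shows "set_integrable lborel (cball a r) f"
  unfolding set_integrable_def using borel_integrable_compact[OF compact_cball assms] by simp

text \<open>Change of variables for a map preserving both Lebesgue measure and the norm. It is used
  for sign changes of one coordinate, swaps of two coordinates and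
  \<open>y \<mapsto> - y\<close>.\<close>

lemma set_integral_cball_invariant:
  fixes f :: "'a::euclidean_space \<Rightarrow> real"
  assumes T: "T \<in> borel_measurable borel" "distr lborel borel T = lborel" "\<And>y. norm (T y) = norm y"
    and f: "continuous_on (cball 0 r) f"
  shows "(LINT y:cball 0 r|lborel. f (T y)) = (LINT y:cball 0 r|lborel. f y)"
proof -
  have "(LINT y:cball 0 r|lborel. f y) = (LINT y|distr lborel borel T. indicat_real (cball 0 r) y *\<^sub>R f y)"
    using T(2) by (simp add: set_lebesgue_integral_def)
  also have "\<dots> = (LINT y|lborel. indicat_real (cball 0 r) (T y) *\<^sub>R f (T y))"
    using T(1) f by (intro integral_distr borel_measurable_continuous_on_indicator) auto
  also have "\<dots> = (LINT y:cball 0 r|lborel. f (T y))"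
    using T(3) by (simp add: set_lebesgue_integral_def indicator_def)
  finally show ?thesis ..
qed

section \<open>Symmetries of Lebesgue measure\<close>

lemma lborel_distr_minus: "distr lborel borel uminus = (lborel :: 'a::euclidean_space measure)"
  using lborel_affine[of "-1::real" "0::'a"] by (simp add: density_1)

lemma prod_Basis_cart: "(\<Prod>b\<in>(Basis :: (real^'n) set). h b) = (\<Prod>i\<in>UNIV. h (axis i 1))"
proof -
  have B: "(Basis :: (real^'n) set) = range (\<lambda>i. axis i 1)" by (auto simp: Basis_vec_def)
  have "inj (\<lambda>i. axis i 1 :: real^'n)" by (auto simp: inj_on_def axis_eq_axis)
  then show ?thesis unfolding B by (subst prod.reindex) (simp_all add: o_def)
qed

text \<open>Lebesgue measure is determined by its values on boxes, and the preimage of a box is the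
  box with permuted sides, whose volume is the same product.\<close>

lemma lborel_distr_permute:
  fixes p :: "'n::finite \<Rightarrow> 'n"
  assumes p: "bij p"
  shows "distr lborel borel (\<lambda>v. \<chi> i. v $ p i) = (lborel :: (real^'n) measure)"
proof (rule lborel_eqI[symmetric])
  have meas: "(\<lambda>v::real^'n. \<chi> i. v $ p i) \<in> borel_measurable borel"
    by (intro borel_measurable_continuous_onI continuous_on_vec_lambda continuous_intros)
  fix l u :: "real^'n" assume le: "\<And>b. b \<in> Basis \<Longrightarrow> l \<bullet> b \<le> u \<bullet> b"
  have le': "l $ i \<le> u $ i" for i using le[of "axis i 1"] by (simp add: inner_axis axis_in_Basis_iff)
  define s where "s w = (\<chi> i. w $ inv p i)" for w :: "real^'n"
  have ip: "inv p (p i) = i" "p (inv p i) = i" for i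
    using p by (simp_all add: bij_is_inj bij_is_surj surj_f_inv_f)
  have pre: "(\<lambda>v::real^'n. \<chi> i. v $ p i) -` box l u = box (s l) (s u)"
    unfolding s_def by (auto simp: mem_box_cart) (metis ip)+
  have "emeasure (distr lborel borel (\<lambda>v. \<chi> i. v $ p i)) (box l u) = emeasure lborel (box (s l) (s u))"
    using meas by (simp add: emeasure_distr pre)
  also have "\<dots> = (\<Prod>b\<in>Basis. (s u - s l) \<bullet> b)"
    using le' by (intro emeasure_lborel_box) (auto simp: Basis_vec_def inner_axis s_def)
  also have "(\<Prod>b\<in>Basis. (s u - s l) \<bullet> b) = (\<Prod>i\<in>UNIV. (u - l) $ inv p i)"
    by (simp add: prod_Basis_cart inner_axis s_def)
  also have "\<dots> = (\<Prod>i\<in>UNIV. (u - l) $ i)"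
    using p by (intro prod.reindex_bij_betw bij_imp_bij_inv)
  also have "\<dots> = (\<Prod>b\<in>Basis. (u - l) \<bullet> b)"
    by (simp add: prod_Basis_cart inner_axis)
  finally show "emeasure (distr lborel borel (\<lambda>v. \<chi> i. v $ p i)) (box l u) = (\<Prod>b\<in>Basis. (u - l) \<bullet> b)" .
qed simp

text \<open>A diagonal linear map with entries 1 and -1 has Jacobian factor 1.\<close>

lemma lborel_distr_reflect:
  fixes k :: "'n::finite"
  shows "distr lborel borel (\<lambda>v. \<chi> i. if i = k then - v $ i else v $ i) = (lborel :: (real^'n) measure)"
proof -
  define c :: "real^'n \<Rightarrow> real" where "c b = (if b = axis k 1 then -1 else 1)" for b
  have "(0 + (\<Sum>j\<in>Basis. (c j * (v \<bullet> j)) *\<^sub>R j)) = (\<chi> i. if i = k then - v $ i else v $ i)" for v :: "real^'n"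
  proof (rule euclidean_eqI)
    fix b :: "real^'n" assume b: "b \<in> Basis"
    then obtain i where "b = axis i 1" by (auto simp: Basis_vec_def)
    moreover have "(0 + (\<Sum>j\<in>Basis. (c j * (v \<bullet> j)) *\<^sub>R j)) \<bullet> b = c b * (v \<bullet> b)"
      using b by simp
    ultimately show "(0 + (\<Sum>j\<in>Basis. (c j * (v \<bullet> j)) *\<^sub>R j)) \<bullet> b = (\<chi> i. if i = k then - v $ i else v $ i) \<bullet> b"
      by (simp add: inner_axis c_def axis_eq_axis)
  qed
  moreover have "(\<Prod>j\<in>Basis. \<bar>c j\<bar>) = 1"
    by (intro prod.neutral) (simp add: c_def)
  moreover have "\<And>j. j \<in> Basis \<Longrightarrow> c j \<noteq> 0" by (simp add: c_def)
  ultimately show ?thesis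
    using lborel_affine_euclidean[of c 0] by (simp add: density_1)
qed

text \<open>Layer cake: \<open>(norm y)\<^sup>2\<close> is the integral of \<open>2 * s\<close> over \<open>0 \<le> s \<le> norm y\<close>.\<close>
lemma set_integral_cball_norm_square:
  assumes r: "r > 0"
  shows "(LINT y:cball (0::'a::euclidean_space) r|lborel. (norm y)\<^sup>2)
    = real DIM('a) / (real DIM('a) + 2) * r\<^sup>2 * measure lborel (cball (0::'a) r)"
proof -
  let ?n = "DIM('a)"
  define \<omega> where "\<omega> = unit_ball_vol (real ?n)"
  have \<omega>: "\<omega> \<ge> 0" by (simp add: \<omega>_def)
  \<comment> \<open>An antiderivative of \<open>f\<close>, where \<open>f s\<close> is
    \<open>2 * s\<close> times the volume of the shell between the radii \<open>s\<close> and
    \<open>r\<close>.\<close>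
  define F where "F s = \<omega> * (s\<^sup>2 * r ^ ?n - 2 * (s ^ (?n + 2) / (real ?n + 2)))" for s
  define f where "f s = 2 * s * (\<omega> * (r ^ ?n - s ^ ?n))" for s :: real
  define K where "K = {(y::'a, s::real). 0 \<le> s \<and> s \<le> norm y \<and> norm y \<le> r}"
  have "closed K" unfolding K_def split_def
    by (intro closed_Collect_conj closed_Collect_le continuous_intros)
  then have "K \<in> sets (borel \<Otimes>\<^sub>M borel)" unfolding borel_prod by (rule borel_closed)
  then have [measurable]: "K \<in> sets (lborel \<Otimes>\<^sub>M lborel)" by simp
  have "(\<integral>\<^sup>+ y\<in>cball 0 r. ennreal ((norm y)\<^sup>2) \<partial>(lborel :: 'a measure))
      = (\<integral>\<^sup>+ y. \<integral>\<^sup>+ s. ennreal (2 * s) * indicator K (y, s) \<partial>lborel \<partial>lborel)"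
  proof (intro nn_integral_cong)
    fix y :: 'a
    show "ennreal ((norm y)\<^sup>2) * indicator (cball 0 r) y = (\<integral>\<^sup>+ s. ennreal (2 * s) * indicator K (y, s) \<partial>lborel)"
    proof (cases "norm y \<le> r")
      case True
      have "(\<integral>\<^sup>+ s. ennreal (2 * s) * indicator {0..norm y} s \<partial>lborel) = (norm y)\<^sup>2 - 0\<^sup>2"
        by (rule nn_integral_FTC_Icc) (auto intro!: derivative_eq_intros)
      moreover have "(\<lambda>s. ennreal (2 * s) * indicator K (y, s)) = (\<lambda>s. ennreal (2 * s) * indicator {0..norm y} s)"
        using True by (auto simp: K_def indicator_def fun_eq_iff)
      ultimately show ?thesis using True by simp
    qed (simp add: K_def)
  qed
  also have "\<dots> = (\<integral>\<^sup>+ s. \<integral>\<^sup>+ y. ennreal (2 * s) * indicator K (y, s) \<partial>lborel \<partial>lborel)"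
    by (rule lborel_pair.Fubini') (simp add: split_def, measurable)
  also have "\<dots> = (\<integral>\<^sup>+ s. ennreal (f s) * indicator {0..r} s \<partial>lborel)"
  proof (intro nn_integral_cong)
    fix s :: real
    show "(\<integral>\<^sup>+ y. ennreal (2 * s) * indicator K (y, s) \<partial>lborel) = ennreal (f s) * indicator {0..r} s"
    proof (cases "0 \<le> s \<and> s \<le> r")
      case True
      \<comment> \<open>For fixed \<open>s\<close> the slice of \<open>K\<close> is the shell of all
        \<open>y\<close> with norm between \<open>s\<close> and \<open>r\<close>.\<close>
      have "(\<integral>\<^sup>+ y. ennreal (2 * s) * indicator K (y, s) \<partial>lborel)
          = (\<integral>\<^sup>+ y. ennreal (2 * s) * indicator (cball (0::'a) r - ball 0 s) y \<partial>lborel)"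
        using True by (intro nn_integral_cong) (auto simp: K_def indicator_def)
      also have "\<dots> = ennreal (2 * s) * emeasure lborel (cball (0::'a) r - ball 0 s)"
        by (rule nn_integral_cmult_indicator) simp
      also have "emeasure lborel (cball (0::'a) r - ball 0 s) = ennreal (\<omega> * r ^ ?n) - ennreal (\<omega> * s ^ ?n)"
        using True r by (subst emeasure_Diff) (auto simp: emeasure_ball emeasure_cball \<omega>_def emeasure_lborel_ball_finite)
      also have "\<dots> = ennreal (\<omega> * (r ^ ?n - s ^ ?n))"
        using True \<omega> by (simp add: ennreal_minus right_diff_distrib)
      also have "ennreal (2 * s) * \<dots> = ennreal (f s)"
        unfolding f_def using True by (subst ennreal_mult') (auto)
      finally show ?thesis using True by simp
    next
      case False
      then have "indicator K (y, s) = (0::ennreal)" for y :: 'a by (auto simp: K_def)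
      with False show ?thesis by auto
    qed
  qed
  also have "\<dots> = F r - F 0"
  proof (rule nn_integral_FTC_Icc)
    show "f \<in> borel_measurable borel" unfolding f_def by measurable
    show "(F has_real_derivative f x) (at x)" for x
    proof -
      have "((\<lambda>s. s ^ (?n + 2) / (real ?n + 2)) has_real_derivative x ^ (?n + 1)) (at x)"
        using DERIV_cdivide[OF DERIV_pow[of "?n + 2" x], of "real ?n + 2"] by (simp add: add.commute)
      note [derivative_intros] = this
      show ?thesis unfolding F_def f_def
        by (rule derivative_eq_intros refl | simp add: algebra_simps)+
    qed
    show "0 \<le> f x" if "x \<in> {0..r}" for x
      using that \<omega> by (simp add: f_def power_mono)
  qed (use r in auto)
  also have "F r - F 0 = real ?n / (real ?n + 2) * r\<^sup>2 * measure lborel (cball (0::'a) r)"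
    using r by (simp add: F_def content_cball \<omega>_def power_add field_simps power2_eq_square)
  finally have nn: "(\<integral>\<^sup>+ y\<in>cball 0 r. ennreal ((norm y)\<^sup>2) \<partial>(lborel :: 'a measure))
      = ennreal (real ?n / (real ?n + 2) * r\<^sup>2 * measure lborel (cball (0::'a) r))" .
  show ?thesis
    unfolding set_lebesgue_integral_def
  proof (rule integral_eq_nn_integral[THEN trans])
    show "(\<lambda>y::'a. indicat_real (cball 0 r) y *\<^sub>R (norm y)\<^sup>2) \<in> borel_measurable lborel"
      using borel_measurable_continuous_on_indicator[of "cball (0::'a) r" "\<lambda>y. (norm y)\<^sup>2"]
      by (simp add: continuous_on_power continuous_on_norm_id)
    have "(\<integral>\<^sup>+ y. ennreal (indicat_real (cball 0 r) y *\<^sub>R (norm y)\<^sup>2) \<partial>(lborel :: 'a measure))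
       = (\<integral>\<^sup>+ y\<in>cball 0 r. ennreal ((norm y)\<^sup>2) \<partial>(lborel :: 'a measure))"
      by (intro nn_integral_cong) (simp add: indicator_def)
    then show "enn2real (\<integral>\<^sup>+ y. ennreal (indicat_real (cball 0 r) y *\<^sub>R (norm y)\<^sup>2) \<partial>(lborel :: 'a measure))
        = real ?n / (real ?n + 2) * r\<^sup>2 * measure lborel (cball (0::'a) r)"
      by (simp add: nn)
  qed auto
qed

text \<open>Only the diagonal second moments survive, and by symmetry they are equal, so the
  integral is the trace times their common value. That value is the integral of the squared norm
  divided by the dimension.\<close>

lemma set_integral_cball_quadratic:
  fixes M :: "real^'n^'n"
  assumes r: "r > 0"
  shows "(LINT y:cball 0 r|lborel. y \<bullet> (M *v y))
    = r\<^sup>2 / (real CARD('n) + 2) * trace M * measure lborel (cball (0::real^'n) r)"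
proof -
  define J where "J i j = (LINT y:cball (0::real^'n) r|lborel. y $ i * y $ j)" for i j
  have int: "set_integrable lborel (cball 0 r) (\<lambda>y::real^'n. y $ i * y $ j)" for i j
    by (intro set_integrable_cball_continuous continuous_intros)
  \<comment> \<open>Reflecting the \<open>i\<close>-th coordinate turns the moment into its
    negative.\<close>
  have off: "J i j = 0" if "i \<noteq> j" for i j
  proof -
    define T :: "real^'n \<Rightarrow> real^'n" where "T v = (\<chi> l. if l = i then - v $ l else v $ l)" for v
    have "J i j = (LINT y:cball (0::real^'n) r|lborel. T y $ i * T y $ j)"
      unfolding J_def
    proof (rule set_integral_cball_invariant[symmetric])
      show "T \<in> borel_measurable borel" unfolding T_def
      proof (intro borel_measurable_continuous_onI continuous_on_vec_lambda)
        show "continuous_on UNIV (\<lambda>v::real^'n. if l = i then - v $ l else v $ l)" for l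
          by (cases "l = i") (auto intro!: continuous_intros)
      qed
      show "distr lborel borel T = lborel" unfolding T_def by (rule lborel_distr_reflect)
      show "norm (T y) = norm y" for y
        unfolding norm_vec_def L2_set_def T_def by (intro arg_cong[where f = sqrt] sum.cong) auto
    qed (intro continuous_intros)
    also have "\<dots> = - J i j"
      using that by (simp add: J_def T_def set_lebesgue_integral_def)
    finally show ?thesis by simp
  qed
  \<comment> \<open>Swapping the coordinates \<open>i\<close> and \<open>j\<close> exchanges the two
    moments.\<close>
  have diag: "J i i = J j j" for i j
  proof -
    define p where "p = Transposition.transpose i j"
    define T :: "real^'n \<Rightarrow> real^'n" where "T v = (\<chi> l. v $ p l)" for v
    have p: "bij p" by (simp add: p_def)
    have "J i i = (LINT y:cball (0::real^'n) r|lborel. T y $ i * T y $ i)"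
      unfolding J_def
    proof (rule set_integral_cball_invariant[symmetric])
      show "T \<in> borel_measurable borel" unfolding T_def
        by (intro borel_measurable_continuous_onI continuous_on_vec_lambda continuous_intros)
      show "distr lborel borel T = lborel" unfolding T_def by (rule lborel_distr_permute[OF p])
      show "norm (T y) = norm y" for y
        unfolding norm_vec_def L2_set_def T_def
        using sum.reindex_bij_betw[OF p, of "\<lambda>i. (norm (y $ i))\<^sup>2"] by simp
    qed (intro continuous_intros)
    also have "\<dots> = J j j" by (simp add: J_def T_def p_def)
    finally show ?thesis .
  qed
  have sumJ: "(\<Sum>i\<in>UNIV. \<Sum>j\<in>UNIV. a i j * J i j) = (LINT y:cball 0 r|lborel. (\<Sum>i\<in>UNIV. \<Sum>j\<in>UNIV. a i j * (y $ i * y $ j)))" for a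
  proof -
    have "integrable lborel (\<lambda>y::real^'n. a i j * (indicat_real (cball 0 r) y *\<^sub>R (y $ i * y $ j)))" for i j
      using int[of i j] unfolding set_integrable_def by (rule integrable_mult_right)
    then have "(\<Sum>i\<in>UNIV. \<Sum>j\<in>UNIV. a i j * J i j)
       = (LINT y|lborel. (\<Sum>i\<in>UNIV. \<Sum>j\<in>UNIV. a i j * (indicat_real (cball 0 r) (y::real^'n) *\<^sub>R (y $ i * y $ j))))"
      by (simp add: J_def set_lebesgue_integral_def Bochner_Integration.integral_sum)
    also have "\<dots> = (LINT y:cball 0 r|lborel. (\<Sum>i\<in>UNIV. \<Sum>j\<in>UNIV. a i j * (y $ i * y $ j)))"
      unfolding set_lebesgue_integral_def
      by (intro Bochner_Integration.integral_cong refl) (simp add: sum_distrib_left mult_ac)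
    finally show ?thesis .
  qed
  \<comment> \<open>An arbitrary index, to name the common value of the diagonal moments.\<close>
  fix k :: 'n
  have collapse: "(\<Sum>i\<in>UNIV. \<Sum>j\<in>UNIV. a i j * J i j) = (\<Sum>i\<in>UNIV. a i i) * J k k" for a
  proof -
    have "(\<Sum>j\<in>UNIV. a i j * J i j) = a i i * J k k" for i
      using off diag[of i k] by (subst sum.remove[of _ i]) (auto intro!: sum.neutral)
    then show ?thesis by (simp add: sum_distrib_right)
  qed
  have "(LINT y:cball (0::real^'n) r|lborel. (norm y)\<^sup>2) = real CARD('n) * J k k"
  proof -
    have "(norm y)\<^sup>2 = (\<Sum>i\<in>UNIV. \<Sum>j\<in>UNIV. (if i = j then 1 else 0) * (y $ i * y $ j))" for y :: "real^'n"
      unfolding power2_norm_eq_inner inner_vec_def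
      by (intro sum.cong refl) (simp add: if_distrib if_distribR cong: if_cong)
    then show ?thesis
      using sumJ[of "\<lambda>i j. if i = j then 1 else 0"] collapse[of "\<lambda>i j. if i = j then 1 else 0"] by simp
  qed
  then have "real CARD('n) * J k k
      = real CARD('n) * (r\<^sup>2 / (real CARD('n) + 2) * measure lborel (cball (0::real^'n) r))"
    using set_integral_cball_norm_square[OF r, where 'a = "real^'n"] by simp
  then have "J k k = r\<^sup>2 / (real CARD('n) + 2) * measure lborel (cball (0::real^'n) r)"
    by (subst (asm) mult_cancel_left) simp
  moreover have "(LINT y:cball 0 r|lborel. y \<bullet> (M *v y)) = trace M * J k k"
  proof -
    have "y \<bullet> (M *v y) = (\<Sum>i\<in>UNIV. \<Sum>j\<in>UNIV. M $ i $ j * (y $ i * y $ j))" for y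
      unfolding inner_vec_def matrix_vector_mult_def by (simp add: sum_distrib_left mult_ac)
    then show ?thesis
      using sumJ[of "\<lambda>i j. M $ i $ j"] collapse[of "\<lambda>i j. M $ i $ j"] by (simp add: trace_def)
  qed
  ultimately show ?thesis by simp
qed

section \<open>Second-order expansion\<close>

lemma has_derivative_gradient:
  fixes f :: "real^'n \<Rightarrow> real"
  assumes "f differentiable (at y)"
  shows "(f has_derivative (\<lambda>h. gradient f y \<bullet> h)) (at y)"
proof -
  let ?L = "frechet_derivative f (at y)"
  have L: "(f has_derivative ?L) (at y)" using assms frechet_derivative_works by blast
  then have lin: "linear ?L" by (rule has_derivative_linear)
  have "?L h = gradient f y \<bullet> h" for h
  proof -
    have "?L h = ?L (\<Sum>i\<in>UNIV. (h $ i) *\<^sub>R axis i 1)"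
      using basis_expansion[of h] by (simp add: scalar_mult_eq_scaleR)
    also have "\<dots> = gradient f y \<bullet> h"
      by (simp add: linear_sum[OF lin] linear_cmul[OF lin] gradient_def inner_vec_def mult.commute)
    finally show ?thesis .
  qed
  then have "?L = (\<lambda>h. gradient f y \<bullet> h)" by (rule ext)
  with L show ?thesis by simp
qed

lemma has_real_derivative_gradient_line:
  fixes f :: "real^'n \<Rightarrow> real"
  assumes "f differentiable (at (y + t *\<^sub>R h))"
  shows "((\<lambda>t. f (y + t *\<^sub>R h)) has_real_derivative gradient f (y + t *\<^sub>R h) \<bullet> h) (at t)"
proof -
  have "((\<lambda>t. y + t *\<^sub>R h) has_derivative (\<lambda>s. s *\<^sub>R h)) (at t)"
    by (auto intro!: derivative_eq_intros)
  from diff_chain_at[OF this has_derivative_gradient[OF assms]]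
  show ?thesis
    by (simp add: has_field_derivative_def o_def mult_commute_abs)
qed

text \<open>The derivative of the gradient at \<open>x\<close> in epsilon-delta form, with the
  radius shrunk so that the ball stays in \<open>S\<close>. Both the Taylor expansion and the
  symmetry of the Hessian start from it.\<close>

lemma gradient_expansion:
  fixes f :: "real^'n \<Rightarrow> real"
  assumes S: "open S" "x \<in> S" and "C2_on f S" and \<eta>: "\<eta> > 0"
  obtains r where "r > 0" "ball x r \<subseteq> S"
    "\<And>h. norm h < r \<Longrightarrow> norm (gradient f (x + h) - gradient f x - hessian f x *v h) \<le> \<eta> * norm h"
proof -
  have "(gradient f has_derivative (\<lambda>h. hessian f x *v h)) (at x)"
    using assms unfolding C2_on_def hessian_def by (simp add: jacobian_works)
  then obtain d where "d > 0" and d: "\<And>y. norm (y - x) < d \<Longrightarrow>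
      norm (gradient f y - gradient f x - hessian f x *v (y - x)) \<le> \<eta> * norm (y - x)"
    unfolding has_derivative_at_alt using \<eta> by blast
  obtain e where "e > 0" "ball x e \<subseteq> S" using S openE by blast
  show thesis
  proof (rule that[of "min d e"])
    show "ball x (min d e) \<subseteq> S" using \<open>ball x e \<subseteq> S\<close> by auto
  qed (use \<open>d > 0\<close> \<open>e > 0\<close> d[of "x + h" for h] in auto)
qed

text \<open>The mean value theorem is applied along the segment to \<phi>, which is \<open>f\<close>
  minus its quadratic Taylor polynomial. Its derivative is the remainder of the gradient expansion
  paired with \<open>h\<close>, so Cauchy-Schwarz finishes.\<close>

lemma second_order_expansion:
  fixes f :: "real^'n \<Rightarrow> real"
  assumes S: "open S" "x \<in> S" and C2: "C2_on f S" and \<eta>: "\<eta> > 0"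
  obtains r where "r > 0" "ball x r \<subseteq> S"
    "\<And>h. norm h < r \<Longrightarrow>
      \<bar>f (x + h) - f x - gradient f x \<bullet> h - (h \<bullet> (hessian f x *v h)) / 2\<bar> \<le> \<eta> * (norm h)\<^sup>2"
proof -
  obtain r where r: "r > 0" "ball x r \<subseteq> S" and grad:
    "\<And>h. norm h < r \<Longrightarrow> norm (gradient f (x + h) - gradient f x - hessian f x *v h) \<le> \<eta> * norm h"
    by (rule gradient_expansion[OF S C2 \<eta>]) blast
  have "\<bar>f (x + h) - f x - gradient f x \<bullet> h - (h \<bullet> (hessian f x *v h)) / 2\<bar> \<le> \<eta> * (norm h)\<^sup>2"
    if h: "norm h < r" for h
  proof -
    have th: "norm (t *\<^sub>R h) < r" if "0 \<le> t" "t \<le> 1" for t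
      using that h mult_left_le_one_le[of "norm h" t] by simp
    define \<phi> where "\<phi> t = f (x + t *\<^sub>R h) - t * (gradient f x \<bullet> h) - t\<^sup>2 * (h \<bullet> (hessian f x *v h)) / 2" for t
    define \<phi>' where "\<phi>' t = (gradient f (x + t *\<^sub>R h) - gradient f x - hessian f x *v (t *\<^sub>R h)) \<bullet> h" for t
    have "(\<phi> has_real_derivative \<phi>' t) (at t)" if "0 \<le> t" "t \<le> 1" for t
    proof -
      have "x + t *\<^sub>R h \<in> S" using th[OF that] r(2) by (auto simp: dist_norm)
      then have "f differentiable (at (x + t *\<^sub>R h))" using C2 by (simp add: C2_on_def)
      note [derivative_intros] = has_real_derivative_gradient_line[OF this]
      show ?thesis
        unfolding \<phi>_def \<phi>'_def
        by (auto intro!: derivative_eq_intros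
            simp: matrix_vector_mult_scaleR inner_diff_left inner_diff_right inner_commute)
    qed
    then obtain t where t: "0 < t" "t < 1" "\<phi> 1 - \<phi> 0 = (1 - 0) * \<phi>' t"
      using MVT2[of 0 1 \<phi> \<phi>'] by auto
    have "\<bar>\<phi>' t\<bar> \<le> norm (gradient f (x + t *\<^sub>R h) - gradient f x - hessian f x *v (t *\<^sub>R h)) * norm h"
      unfolding \<phi>'_def by (rule Cauchy_Schwarz_ineq2)
    also have "\<dots> \<le> \<eta> * norm (t *\<^sub>R h) * norm h"
      using t by (intro mult_right_mono grad th) auto
    also have "\<dots> \<le> \<eta> * norm h * norm h"
      using t \<eta> by (intro mult_right_mono mult_left_mono) (auto intro!: mult_left_le_one_le)
    finally show ?thesis using t(3) by (simp add: \<phi>_def power2_eq_square mult_ac)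
  qed
  with that r show ?thesis by blast
qed

text \<open>The mixed second difference does not change when \<open>a\<close> and \<open>b\<close>
  are exchanged, whereas \<open>a \<bullet> (H *v b)\<close> might. Comparing the two orders is what
  yields the symmetry of the Hessian.\<close>

lemma second_difference_bound:
  fixes f :: "real^'n \<Rightarrow> real"
  assumes diff: "\<And>h. norm h < r \<Longrightarrow> f differentiable (at (x + h))"
    and grad: "\<And>h. norm h < r \<Longrightarrow> norm (gradient f (x + h) - gradient f x - H *v h) \<le> \<eta> * norm h"
    and s: "s > 0" "s * (norm a + norm b) < r" and \<eta>: "\<eta> \<ge> 0"
  shows "\<bar>f (x + s *\<^sub>R a + s *\<^sub>R b) - f (x + s *\<^sub>R a) - f (x + s *\<^sub>R b) + f x - s\<^sup>2 * (a \<bullet> (H *v b))\<bar>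
    \<le> 2 * \<eta> * s\<^sup>2 * (norm a + norm b)\<^sup>2"
proof -
  let ?m = "norm a + norm b"
  have ta: "norm (t *\<^sub>R a) \<le> s * ?m" "norm (s *\<^sub>R b + t *\<^sub>R a) \<le> s * ?m" if "0 \<le> t" "t \<le> s" for t
  proof -
    have "t * norm a \<le> s * norm a" using that by (simp add: mult_right_mono)
    moreover have "norm (s *\<^sub>R b + t *\<^sub>R a) \<le> s * norm b + t * norm a"
      using norm_triangle_ineq[of "s *\<^sub>R b" "t *\<^sub>R a"] s that by simp
    moreover have "0 \<le> s * norm b" using s by simp
    moreover have "norm (t *\<^sub>R a) = t * norm a" using that by simp
    ultimately show "norm (t *\<^sub>R a) \<le> s * ?m" "norm (s *\<^sub>R b + t *\<^sub>R a) \<le> s * ?m"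
      unfolding distrib_left by linarith+
  qed
  \<comment> \<open>The increment of \<open>f\<close> by \<open>s *\<^sub>R b\<close>, followed
    along \<open>a\<close>: its own increment over \<open>0 \<le> t \<le> s\<close> is the mixed
    second difference.\<close>
  define \<psi> where "\<psi> t = f ((x + s *\<^sub>R b) + t *\<^sub>R a) - f (x + t *\<^sub>R a)" for t
  define \<psi>' where "\<psi>' t = gradient f ((x + s *\<^sub>R b) + t *\<^sub>R a) \<bullet> a - gradient f (x + t *\<^sub>R a) \<bullet> a" for t
  have "(\<psi> has_real_derivative \<psi>' t) (at t)" if "0 \<le> t" "t \<le> s" for t
    unfolding \<psi>_def \<psi>'_def
    using ta[OF that] s diff[of "t *\<^sub>R a"] diff[of "s *\<^sub>R b + t *\<^sub>R a"]
    by (intro DERIV_diff has_real_derivative_gradient_line) (auto simp: add.assoc)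
  then obtain t where t: "0 < t" "t < s" and eq: "\<psi> s - \<psi> 0 = (s - 0) * \<psi>' t"
    using MVT2[of 0 s \<psi> \<psi>'] s by auto
  let ?e = "\<lambda>h. gradient f (x + h) - gradient f x - H *v h"
  \<comment> \<open>The linear parts of the two gradient expansions differ by exactly
    \<open>s *\<^sub>R (H *v b)\<close>, so only the two remainders are left.\<close>
  have "\<psi>' t - s * (a \<bullet> (H *v b)) = (?e (s *\<^sub>R b + t *\<^sub>R a) - ?e (t *\<^sub>R a)) \<bullet> a"
    by (simp add: \<psi>'_def matrix_vector_right_distrib matrix_vector_mult_scaleR inner_diff_left
        inner_diff_right inner_add_left inner_add_right inner_commute add.assoc)
  also have "\<bar>\<dots>\<bar> \<le> norm (?e (s *\<^sub>R b + t *\<^sub>R a) - ?e (t *\<^sub>R a)) * norm a"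
    by (rule Cauchy_Schwarz_ineq2)
  also have "\<dots> \<le> (\<eta> * (s * ?m) + \<eta> * (s * ?m)) * ?m"
  proof (rule mult_mono)
    have "norm (?e (s *\<^sub>R b + t *\<^sub>R a)) \<le> \<eta> * norm (s *\<^sub>R b + t *\<^sub>R a)"
      using ta[of t] t s by (intro grad) auto
    moreover have "norm (?e (t *\<^sub>R a)) \<le> \<eta> * norm (t *\<^sub>R a)"
      using ta[of t] t s by (intro grad) auto
    moreover have "\<eta> * norm (s *\<^sub>R b + t *\<^sub>R a) \<le> \<eta> * (s * ?m)" "\<eta> * norm (t *\<^sub>R a) \<le> \<eta> * (s * ?m)"
      using ta[of t] t \<eta> by (auto intro!: mult_left_mono)
    ultimately show "norm (?e (s *\<^sub>R b + t *\<^sub>R a) - ?e (t *\<^sub>R a)) \<le> \<eta> * (s * ?m) + \<eta> * (s * ?m)"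
      using norm_triangle_ineq4[of "?e (s *\<^sub>R b + t *\<^sub>R a)" "?e (t *\<^sub>R a)"] by linarith
  qed (use s \<eta> in auto)
  finally have "\<bar>\<psi>' t - s * (a \<bullet> (H *v b))\<bar> \<le> 2 * \<eta> * s * ?m\<^sup>2"
    by (simp add: power2_eq_square mult_ac)
  then have "s * \<bar>\<psi>' t - s * (a \<bullet> (H *v b))\<bar> \<le> s * (2 * \<eta> * s * ?m\<^sup>2)"
    using s by (intro mult_left_mono) auto
  moreover have "s * \<bar>\<psi>' t - s * (a \<bullet> (H *v b))\<bar> = \<bar>s * \<psi>' t - s\<^sup>2 * (a \<bullet> (H *v b))\<bar>"
    using s by (simp add: abs_mult_pos' right_diff_distrib power2_eq_square mult.assoc)
  moreover have "s * \<psi>' t = f (x + s *\<^sub>R a + s *\<^sub>R b) - f (x + s *\<^sub>R a) - f (x + s *\<^sub>R b) + f x"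
    using eq by (simp add: \<psi>_def add_ac)
  ultimately show ?thesis by (simp add: power2_eq_square mult_ac)
qed

text \<open>One mixed second difference approximates both
  \<open>s\<^sup>2 * (a \<bullet> (?H *v b))\<close> and
  \<open>s\<^sup>2 * (b \<bullet> (?H *v a))\<close>; after cancelling \<open>s\<^sup>2\<close> the
  discrepancy is below every positive \<open>e\<close>.\<close>

lemma hessian_symmetric:
  fixes f :: "real^'n \<Rightarrow> real"
  assumes S: "open S" "x \<in> S" and C2: "C2_on f S"
  shows "transpose (hessian f x) = hessian f x"
proof -
  let ?H = "hessian f x"
  have "a \<bullet> (?H *v b) = b \<bullet> (?H *v a)" for a b
  proof -
    let ?m = "norm a + norm b"
    have "\<bar>a \<bullet> (?H *v b) - b \<bullet> (?H *v a)\<bar> \<le> 0 + e" if e: "e > 0" for e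
    proof -
      \<comment> \<open>Each of the two estimates costs \<open>2 * \<eta> * ?m\<^sup>2\<close> after
        division by \<open>s\<^sup>2\<close>; \<open>+ 1\<close> covers
        \<open>a = b = 0\<close>.\<close>
      define \<eta> where "\<eta> = e / (4 * (?m\<^sup>2 + 1))"
      have m1: "?m\<^sup>2 + 1 > 0" by (smt (verit) zero_le_power2)
      have \<eta>: "\<eta> > 0" using e m1 by (simp add: \<eta>_def)
      obtain r where r: "r > 0" "ball x r \<subseteq> S" and grad:
        "\<And>h. norm h < r \<Longrightarrow> norm (gradient f (x + h) - gradient f x - ?H *v h) \<le> \<eta> * norm h"
        by (rule gradient_expansion[OF S C2 \<eta>]) blast
      have diff: "f differentiable (at (x + h))" if "norm h < r" for h
      proof -
        have "x + h \<in> S" using that r by (auto simp: dist_norm)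
        then show ?thesis using C2 by (simp add: C2_on_def)
      qed
      define s where "s = r / (2 * (?m + 1))"
      have m0: "?m \<ge> 0" by simp
      have s: "s > 0" unfolding s_def using r m0 by (intro divide_pos_pos mult_pos_pos) linarith+
      have sr: "s * ?m < r"
      proof -
        have "s * ?m \<le> s * (?m + 1)" using s by simp
        also have "\<dots> = r / 2"
        proof -
          have "r / (2 * c) * c = r / 2" if "c \<noteq> 0" for c by (simp add: that)
          moreover have "?m + 1 \<noteq> 0" using m0 by linarith
          ultimately show ?thesis unfolding s_def .
        qed
        finally show ?thesis using r by simp
      qed
      have sr': "s * (norm b + norm a) < r" using sr by (simp add: add.commute)
      have "\<bar>s\<^sup>2 * (a \<bullet> (?H *v b)) - s\<^sup>2 * (b \<bullet> (?H *v a))\<bar> \<le> 4 * \<eta> * s\<^sup>2 * ?m\<^sup>2"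
        using second_difference_bound[OF diff grad s sr less_imp_le[OF \<eta>]]
          second_difference_bound[OF diff grad s sr' less_imp_le[OF \<eta>]]
        by (simp add: add_ac abs_le_iff)
      then have "s\<^sup>2 * \<bar>a \<bullet> (?H *v b) - b \<bullet> (?H *v a)\<bar> \<le> s\<^sup>2 * (4 * \<eta> * ?m\<^sup>2)"
        by (simp add: abs_mult right_diff_distrib[symmetric] mult_ac)
      then have "\<bar>a \<bullet> (?H *v b) - b \<bullet> (?H *v a)\<bar> \<le> 4 * \<eta> * ?m\<^sup>2"
        using s by simp
      also have "\<dots> \<le> 4 * \<eta> * (?m\<^sup>2 + 1)" using \<eta> by simp
      also have "\<dots> = e"
      proof -
        have "4 * (e / (4 * c)) * c = e" if "c \<noteq> 0" for c by (simp add: that)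
        moreover have "?m\<^sup>2 + 1 \<noteq> 0" using m1 by linarith
        ultimately show ?thesis unfolding \<eta>_def .
      qed
      finally show ?thesis by simp
    qed
    then have "\<bar>a \<bullet> (?H *v b) - b \<bullet> (?H *v a)\<bar> \<le> 0" by (rule field_le_epsilon)
    then show ?thesis by simp
  qed
  from this[of "axis i 1" "axis j 1" for i j] have "?H $ i $ j = ?H $ j $ i" for i j
    by (simp add: inner_axis' matrix_vector_mul_component inner_axis)
  then show ?thesis by (simp add: transpose_def vec_eq_iff)
qed

section \<open>Means over ellipsoids\<close>

text \<open>Cauchy-Schwarz in each row; \<open>norm A\<close> is the Frobenius norm.\<close>

lemma norm_matrix_vector_le:
  fixes A :: "real^'n^'m"
  shows "norm (A *v y) \<le> norm A * norm y"
proof -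
  have "(norm (A *v y))\<^sup>2 = (\<Sum>i\<in>UNIV. (A $ i \<bullet> y)\<^sup>2)"
    unfolding power2_norm_eq_inner inner_vec_def[of "A *v y"] by (simp add: matrix_vector_mul_component power2_eq_square)
  also have "\<dots> \<le> (\<Sum>i\<in>UNIV. (norm (A $ i))\<^sup>2 * (norm y)\<^sup>2)"
    by (intro sum_mono) (metis Cauchy_Schwarz_ineq power2_norm_eq_inner)
  also have "\<dots> = (norm A * norm y)\<^sup>2"
    by (simp add: power_mult_distrib power2_norm_eq_inner inner_vec_def[of A A] sum_distrib_right)
  finally show ?thesis by (rule power2_le_imp_le) simp
qed

lemma inner_symmetric_conj:
  fixes A H :: "real^'n^'n"
  assumes "transpose A = A"
  shows "y \<bullet> ((A ** H ** A) *v y) = (A *v y) \<bullet> (H *v (A *v y))"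
  by (simp add: symmetric_matrix_inner[OF assms] matrix_vector_mul_assoc matrix_mul_assoc)

text \<open>The trace sums the form of \<open>H\<close> over the images of the axes under
  \<open>A\<close>, which are the rows of \<open>A\<close> by symmetry. It makes the second-order
  term large for eccentric ellipsoids.\<close>

lemma trace_symmetric_conj_ge:
  fixes A H :: "real^'n^'n"
  assumes A: "transpose A = A" and H: "\<And>v. c * (norm v)\<^sup>2 \<le> v \<bullet> (H *v v)"
  shows "c * (norm A)\<^sup>2 \<le> trace (A ** H ** A)"
proof -
  have row: "A *v axis i 1 = A $ i" for i
    using A by (metis column_transpose matrix_vector_mult_basis row_def vec_nth_inverse)
  have "c * (norm A)\<^sup>2 = (\<Sum>i\<in>UNIV. c * (norm (A $ i))\<^sup>2)"
    by (simp add: power2_norm_eq_inner inner_vec_def[of A A] sum_distrib_left)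
  also have "\<dots> \<le> (\<Sum>i\<in>UNIV. A $ i \<bullet> (H *v (A $ i)))" by (intro sum_mono H)
  also have "\<dots> = (\<Sum>i\<in>UNIV. axis i 1 \<bullet> ((A ** H ** A) *v axis i 1))"
    by (simp add: inner_symmetric_conj[OF A] row)
  also have "\<dots> = trace (A ** H ** A)"
    by (simp add: trace_def matrix_vector_mul_component inner_axis inner_axis')
  finally show ?thesis .
qed

text \<open>Half of the symmetric second difference: the gradient cancels, and over a centred ball
  it has the same integral as \<open>u (x + h) - u x\<close> with \<open>h = A *v y\<close>.\<close>

definition central_diff :: "('a::real_vector \<Rightarrow> real) \<Rightarrow> 'a \<Rightarrow> 'a \<Rightarrow> real" where
  "central_diff u x h = (u (x + h) + u (x - h)) / 2 - u x"

lemma central_diff_nonneg: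
  assumes u: "convex_on S u" and "x + h \<in> S" "x - h \<in> S"
  shows "0 \<le> central_diff u x h"
proof -
  have "u ((1 - 1/2) *\<^sub>R (x - h) + (1/2) *\<^sub>R (x + h)) \<le> (1 - 1/2) * u (x - h) + (1/2) * u (x + h)"
    using assms by (intro convex_onD[OF u]) auto
  moreover have "(1 - 1/2) *\<^sub>R (x - h) + (1/2) *\<^sub>R (x + h) = x"
    by (simp add: scaleR_add_right scaleR_diff_right flip: scaleR_left_distrib)
  ultimately show ?thesis by (simp add: central_diff_def field_simps)
qed

text \<open>Difference quotients of a convex function increase along rays; this is applied to
  \<open>h\<close> and \<open>- h\<close>. It carries information near \<open>x\<close> to
  displacements beyond the reach of the Taylor expansion.\<close>

lemma central_diff_scale:
  assumes u: "convex_on S u" and x: "x \<in> S" "x + h \<in> S" "x - h \<in> S" and t: "t \<ge> 1"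
  shows "t * central_diff u x (h /\<^sub>R t) \<le> central_diff u x h"
proof -
  have le: "t * (u (x + k /\<^sub>R t) - u x) \<le> u (x + k) - u x" if "x + k \<in> S" for k
  proof -
    have "u ((1 - 1/t) *\<^sub>R x + (1/t) *\<^sub>R (x + k)) \<le> (1 - 1/t) * u x + (1/t) * u (x + k)"
      using that x t by (intro convex_onD[OF u]) auto
    moreover have "(1 - 1/t) *\<^sub>R x + (1/t) *\<^sub>R (x + k) = x + k /\<^sub>R t"
      by (simp add: algebra_simps inverse_eq_divide)
    ultimately have "u (x + k /\<^sub>R t) - u x \<le> (u (x + k) - u x) / t"
      by (simp add: algebra_simps diff_divide_distrib inverse_eq_divide)
    then show ?thesis using t by (simp add: pos_le_divide_eq mult.commute)
  qed
  have "t * central_diff u x (h /\<^sub>R t) = (t * (u (x + h /\<^sub>R t) - u x) + t * (u (x + (- h) /\<^sub>R t) - u x)) / 2"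
    by (simp add: central_diff_def field_simps)
  also have "\<dots> \<le> ((u (x + h) - u x) + (u (x + (- h)) - u x)) / 2"
    using le[of h] le[of "- h"] x by simp
  also have "\<dots> = central_diff u x h" by (simp add: central_diff_def field_simps)
  finally show ?thesis .
qed

text \<open>The gradient terms at \<open>h\<close> and \<open>- h\<close> cancel and the two Taylor
  errors are averaged, so the error bound is unchanged.\<close>

lemma central_diff_expansion:
  fixes u :: "real^'n \<Rightarrow> real"
  assumes S: "open S" "x \<in> S" and C2: "C2_on u S" and \<eta>: "\<eta> > 0"
  obtains r where "r > 0" "ball x r \<subseteq> S"
    "\<And>h. norm h < r \<Longrightarrow> \<bar>central_diff u x h - (h \<bullet> (hessian u x *v h)) / 2\<bar> \<le> \<eta> * (norm h)\<^sup>2"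
proof -
  obtain r where r: "r > 0" "ball x r \<subseteq> S" and ex: "\<And>h. norm h < r \<Longrightarrow>
      \<bar>u (x + h) - u x - gradient u x \<bullet> h - (h \<bullet> (hessian u x *v h)) / 2\<bar> \<le> \<eta> * (norm h)\<^sup>2"
    by (rule second_order_expansion[OF S C2 \<eta>]) blast
  have "\<bar>central_diff u x h - (h \<bullet> (hessian u x *v h)) / 2\<bar> \<le> \<eta> * (norm h)\<^sup>2" if h: "norm h < r" for h
  proof -
    have m: "(- h) \<bullet> (hessian u x *v (- h)) = h \<bullet> (hessian u x *v h)"
      using matrix_vector_mult_scaleR[of "hessian u x" "-1" h] by simp
    have "\<bar>u (x - h) - u x + gradient u x \<bullet> h - (h \<bullet> (hessian u x *v h)) / 2\<bar> \<le> \<eta> * (norm h)\<^sup>2"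
      using ex[of "- h"] h unfolding m by simp
    with ex[OF h] show ?thesis unfolding central_diff_def abs_le_iff by (simp add: field_simps)
  qed
  with that r show ?thesis by blast
qed

text \<open>Convexity makes the central difference at \<open>s *\<^sub>R h\<close> nonnegative.
  Dividing its expansion by \<open>s\<^sup>2\<close> leaves half of the form up to an error that
  \<eta> makes arbitrarily small.\<close>

lemma convex_hessian_psd:
  fixes u :: "real^'n \<Rightarrow> real"
  assumes S: "open S" "x \<in> S" and C2: "C2_on u S" and u: "convex_on S u"
  shows "0 \<le> h \<bullet> (hessian u x *v h)"
proof -
  let ?q = "h \<bullet> (hessian u x *v h)"
  have "- ?q / 2 \<le> 0 + e" if e: "e > 0" for e
  proof -
    define \<eta> where "\<eta> = e / ((norm h)\<^sup>2 + 1)"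
    have p: "(norm h)\<^sup>2 + 1 > 0" by (smt (verit) zero_le_power2)
    have \<eta>: "\<eta> > 0" using e p by (simp add: \<eta>_def)
    obtain r where r: "r > 0" "ball x r \<subseteq> S" and ex:
      "\<And>h. norm h < r \<Longrightarrow> \<bar>central_diff u x h - (h \<bullet> (hessian u x *v h)) / 2\<bar> \<le> \<eta> * (norm h)\<^sup>2"
      by (rule central_diff_expansion[OF S C2 \<eta>]) blast
    define s where "s = r / (2 * (norm h + 1))"
    have s: "s > 0" unfolding s_def using r by (intro divide_pos_pos mult_pos_pos) (auto intro: add_nonneg_pos)
    have sh: "norm (s *\<^sub>R h) < r"
    proof -
      have "norm (s *\<^sub>R h) \<le> s * (norm h + 1)" using s by simp
      also have "\<dots> = r / 2"
      proof -
        have "r / (2 * c) * c = r / 2" if "c \<noteq> 0" for c by (simp add: that)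
        moreover have "norm h + 1 \<noteq> 0" by (smt (verit) norm_ge_zero)
        ultimately show ?thesis unfolding s_def .
      qed
      finally show ?thesis using r by simp
    qed
    then have "x + s *\<^sub>R h \<in> S" "x - s *\<^sub>R h \<in> S" using r by (auto simp: dist_norm)
    then have "0 \<le> central_diff u x (s *\<^sub>R h)" by (rule central_diff_nonneg[OF u])
    moreover have "(s *\<^sub>R h) \<bullet> (hessian u x *v (s *\<^sub>R h)) = s\<^sup>2 * ?q"
      "(norm (s *\<^sub>R h))\<^sup>2 = s\<^sup>2 * (norm h)\<^sup>2"
      by (simp_all add: matrix_vector_mult_scaleR power_mult_distrib power2_eq_square)
    ultimately have "- (s\<^sup>2 * ?q) / 2 \<le> \<eta> * (s\<^sup>2 * (norm h)\<^sup>2)"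
      using ex[OF sh] unfolding abs_le_iff by simp
    then have "s\<^sup>2 * (- ?q / 2) \<le> s\<^sup>2 * (\<eta> * (norm h)\<^sup>2)" by (simp add: mult_ac)
    then have "- ?q / 2 \<le> \<eta> * (norm h)\<^sup>2"
      using s by (simp only: mult_le_cancel_left_pos zero_less_power)
    also have "\<dots> \<le> \<eta> * ((norm h)\<^sup>2 + 1)" using \<eta> by simp
    also have "\<dots> = e" using p unfolding \<eta>_def by simp
    finally show ?thesis by simp
  qed
  then have "- ?q / 2 \<le> 0" by (rule field_le_epsilon)
  then show ?thesis by simp
qed

section \<open>Admissible ellipsoids and their means\<close>

lemma admissible_mem:
  assumes A: "A \<in> admissible \<Omega> \<epsilon> x" and y: "y \<in> cball 0 \<epsilon>"
  shows "x + A *v y \<in> \<Omega>" "x - A *v y \<in> \<Omega>"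
proof -
  have "(\<lambda>y. x + A *v y) ` cball 0 \<epsilon> \<subseteq> \<Omega>"
    using A by (auto simp: admissible_def simp flip: ellipsoid_eq_image)
  moreover have "- y \<in> cball 0 \<epsilon>" using y by simp
  ultimately have "x + A *v y \<in> \<Omega>" "x + A *v (- y) \<in> \<Omega>" using y by blast+
  then show "x + A *v y \<in> \<Omega>" "x - A *v y \<in> \<Omega>"
    using matrix_vector_mult_scaleR[of A "-1" y] by simp_all
qed

lemma admissibleI:
  fixes A :: "real^'n^'n"
  assumes "sym_pos_def A" "det A = 1" "norm A * \<epsilon> < r" "ball x r \<subseteq> \<Omega>"
  shows "A \<in> admissible \<Omega> \<epsilon> x"
proof -
  have "x + A *v y \<in> \<Omega>" if "y \<in> cball 0 \<epsilon>" for y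
  proof -
    have "norm (A *v y) \<le> norm A * norm y" by (rule norm_matrix_vector_le)
    also have "\<dots> \<le> norm A * \<epsilon>" using that by (intro mult_left_mono) auto
    finally show ?thesis using assms(3,4) by (auto simp: dist_norm)
  qed
  then show ?thesis using assms(1,2) by (auto simp: admissible_def ellipsoid_eq_image)
qed

lemma continuous_on_matrix_vector [continuous_intros]:
  fixes A :: "real^'n^'m"
  assumes "continuous_on S f"
  shows "continuous_on S (\<lambda>y. A *v f y)"
  using assms by (rule bounded_linear.continuous_on[OF matrix_vector_mul_bounded_linear])

context
  fixes \<Omega> :: "(real^'n) set" and u :: "real^'n \<Rightarrow> real" and x :: "real^'n" and \<epsilon> :: real and A :: "real^'n^'n"
  assumes cont: "continuous_on \<Omega> u" and \<epsilon>: "\<epsilon> > 0" and A: "A \<in> admissible \<Omega> \<epsilon> x"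
begin

lemma continuous_on_central_diff_admissible: "continuous_on (cball 0 \<epsilon>) (\<lambda>y. central_diff u x (A *v y))"
proof -
  have "continuous_on (cball 0 \<epsilon>) (\<lambda>y. u (x + A *v y))" "continuous_on (cball 0 \<epsilon>) (\<lambda>y. u (x - A *v y))"
    using admissible_mem[OF A]
    by (auto intro!: continuous_on_compose2[OF cont] continuous_intros)
  then show ?thesis unfolding central_diff_def by (intro continuous_intros) auto
qed

text \<open>The ball is invariant under \<open>y \<mapsto> - y\<close>, so
  \<open>u (x + A *v y)\<close> and \<open>u (x - A *v y)\<close> have the same mean.\<close>

lemma ellipsoid_mean_central_diff:
  "ellipsoid_mean u \<epsilon> A x - u x =
    (1 / measure lborel (cball (0::real^'n) \<epsilon>)) * (LINT y:cball 0 \<epsilon>|lborel. central_diff u x (A *v y))"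
proof -
  let ?B = "cball (0::real^'n) \<epsilon>" and ?V = "measure lborel (cball (0::real^'n) \<epsilon>)"
  have V: "?V > 0" using \<epsilon> by (simp add: content_cball_pos)
  have c1: "continuous_on ?B (\<lambda>y. u (x + A *v y))" and c2: "continuous_on ?B (\<lambda>y. u (x - A *v y))"
    using admissible_mem[OF A]
    by (auto intro!: continuous_on_compose2[OF cont] continuous_intros)
  have refl: "(LINT y:?B|lborel. u (x - A *v y)) = (LINT y:?B|lborel. u (x + A *v y))"
  proof -
    have "(LINT y:?B|lborel. u (x + A *v (- y))) = (LINT y:?B|lborel. u (x + A *v y))"
      by (rule set_integral_cball_invariant[OF _ lborel_distr_minus _ c1]) auto
    moreover have "A *v (- y) = - (A *v y)" for y
      using matrix_vector_mult_scaleR[of A "-1" y] by simp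
    ultimately show ?thesis by simp
  qed
  have i1: "set_integrable lborel ?B (\<lambda>y. u (x + A *v y) / 2)"
    and i2: "set_integrable lborel ?B (\<lambda>y. u (x - A *v y) / 2)"
    and i3: "set_integrable lborel ?B (\<lambda>y. u x)"
    using c1 c2 by (auto intro!: set_integrable_cball_continuous continuous_intros)
  have "(LINT y:?B|lborel. central_diff u x (A *v y))
      = (LINT y:?B|lborel. (u (x + A *v y) / 2 + u (x - A *v y) / 2) - u x)"
    by (simp add: central_diff_def add_divide_distrib)
  also have "\<dots> = (LINT y:?B|lborel. u (x + A *v y) / 2) + (LINT y:?B|lborel. u (x - A *v y) / 2)
      - (LINT y:?B|lborel. u x)"
    using i1 i2 i3 by (simp add: set_integral_diff(2) set_integral_add)
  also have "(LINT y:?B|lborel. u x) = ?V * u x"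
    by (subst set_integral_const) (use emeasure_lborel_cball_finite[of "0::real^'n" \<epsilon>] in auto)
  finally have "(LINT y:?B|lborel. central_diff u x (A *v y)) = (LINT y:?B|lborel. u (x + A *v y)) - ?V * u x"
    by (simp add: refl)
  then show ?thesis using V by (simp add: ellipsoid_mean_def field_simps)
qed

text \<open>The pulled-back form has matrix \<open>A ** H ** A\<close>, whose mean over the ball is
  a multiple of its trace. The factor \<open>k\<close> is free because it is 0 for the bound by
  \<open>u x\<close>, close to 1/2 where the expansion holds, and smaller for eccentric
  ellipsoids.\<close>

lemma ellipsoid_mean_ge:
  assumes "\<And>y. y \<in> cball 0 \<epsilon> \<Longrightarrow> k * ((A *v y) \<bullet> (H *v (A *v y))) \<le> central_diff u x (A *v y)"
  shows "u x + k * \<epsilon>\<^sup>2 / (real CARD('n) + 2) * trace (A ** H ** A) \<le> ellipsoid_mean u \<epsilon> A x"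
proof -
  let ?B = "cball (0::real^'n) \<epsilon>" and ?V = "measure lborel (cball (0::real^'n) \<epsilon>)"
  have V: "?V > 0" using \<epsilon> by (simp add: content_cball_pos)
  have symA: "transpose A = A" using A by (simp add: admissible_def sym_pos_def_def)
  have "(LINT y:?B|lborel. k * (y \<bullet> ((A ** H ** A) *v y))) \<le> (LINT y:?B|lborel. central_diff u x (A *v y))"
    using assms continuous_on_central_diff_admissible
    by (intro set_integral_mono set_integrable_cball_continuous)
       (auto simp: inner_symmetric_conj[OF symA] intro!: continuous_intros)
  then have "(k * \<epsilon>\<^sup>2 / (real CARD('n) + 2) * trace (A ** H ** A)) * ?V
      \<le> (LINT y:?B|lborel. central_diff u x (A *v y))"
    by (simp add: set_integral_cball_quadratic[OF \<epsilon>] mult_ac)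
  then have "k * \<epsilon>\<^sup>2 / (real CARD('n) + 2) * trace (A ** H ** A) \<le> ellipsoid_mean u \<epsilon> A x - u x"
    unfolding ellipsoid_mean_central_diff using V by (simp add: pos_le_divide_eq)
  then show ?thesis by simp
qed

text \<open>Counterpart for the upper bound; the constant \<open>m\<close> takes up the error of the
  expansion.\<close>

lemma ellipsoid_mean_le:
  assumes "\<And>y. y \<in> cball 0 \<epsilon> \<Longrightarrow> central_diff u x (A *v y) \<le> k * ((A *v y) \<bullet> (H *v (A *v y))) + m"
  shows "ellipsoid_mean u \<epsilon> A x \<le> u x + k * \<epsilon>\<^sup>2 / (real CARD('n) + 2) * trace (A ** H ** A) + m"
proof -
  let ?B = "cball (0::real^'n) \<epsilon>" and ?V = "measure lborel (cball (0::real^'n) \<epsilon>)"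
  have V: "?V > 0" using \<epsilon> by (simp add: content_cball_pos)
  have symA: "transpose A = A" using A by (simp add: admissible_def sym_pos_def_def)
  have i1: "set_integrable lborel ?B (\<lambda>y. k * (y \<bullet> ((A ** H ** A) *v y)))"
    and i2: "set_integrable lborel ?B (\<lambda>y. m)"
    by (auto intro!: set_integrable_cball_continuous continuous_intros)
  have "(LINT y:?B|lborel. central_diff u x (A *v y)) \<le> (LINT y:?B|lborel. k * (y \<bullet> ((A ** H ** A) *v y)) + m)"
    using assms continuous_on_central_diff_admissible
    by (intro set_integral_mono set_integrable_cball_continuous)
       (auto simp: inner_symmetric_conj[OF symA] intro!: continuous_intros)
  also have "\<dots> = (LINT y:?B|lborel. k * (y \<bullet> ((A ** H ** A) *v y))) + (LINT y:?B|lborel. m)"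
    by (rule set_integral_add(2)[OF i1 i2])
  also have "(LINT y:?B|lborel. m) = ?V * m"
    by (subst set_integral_const) (use emeasure_lborel_cball_finite[of "0::real^'n" \<epsilon>] in auto)
  finally have "(LINT y:?B|lborel. central_diff u x (A *v y))
      \<le> (k * \<epsilon>\<^sup>2 / (real CARD('n) + 2) * trace (A ** H ** A) + m) * ?V"
    by (simp add: set_integral_cball_quadratic[OF \<epsilon>] algebra_simps)
  then have "ellipsoid_mean u \<epsilon> A x - u x \<le> k * \<epsilon>\<^sup>2 / (real CARD('n) + 2) * trace (A ** H ** A) + m"
    unfolding ellipsoid_mean_central_diff using V by (simp add: pos_divide_le_eq)
  then show ?thesis by simp
qed

end

section \<open>Upper and lower bounds for the means at a fixed point\<close>

context
  fixes \<Omega> :: "(real^'n) set" and u :: "real^'n \<Rightarrow> real" and x :: "real^'n"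
  assumes op: "open \<Omega>" and u: "convex_on \<Omega> u" and C2: "C2_on u \<Omega>" and x: "x \<in> \<Omega>"
begin

lemma C2_on_continuous: "continuous_on \<Omega> u"
  using C2 unfolding C2_on_def
  by (meson continuous_at_imp_continuous_on differentiable_imp_continuous_within)

text \<open>Central differences of a convex function are nonnegative. Besides settling the case of a
  singular Hessian, this bounds the means from below, as the infimum requires.\<close>

lemma ellipsoid_mean_ge_center:
  assumes "\<epsilon> > 0" "A \<in> admissible \<Omega> \<epsilon> x"
  shows "u x \<le> ellipsoid_mean u \<epsilon> A x"
  using ellipsoid_mean_ge[OF C2_on_continuous assms, of 0 "mat 1"]
    central_diff_nonneg[OF u admissible_mem[OF assms(2)]] by simp

text \<open>\<open>A\<close> is chosen before \<epsilon>, so for small \<epsilon> its ellipsoid lies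
  inside the ball on which the expansion holds.\<close>

lemma ellipsoid_mean_near_optimal:
  assumes "\<delta> > 0"
  obtains A where "\<forall>\<^sub>F \<epsilon> in at_right 0. A \<in> admissible \<Omega> \<epsilon> x \<and>
    ellipsoid_mean u \<epsilon> A x \<le> u x + (real CARD('n) / (2 * (real CARD('n) + 2))
      * det (hessian u x) powr (1 / real CARD('n)) + \<delta>) * \<epsilon>\<^sup>2"
proof -
  let ?n = "real CARD('n)" and ?H = "hessian u x"
  let ?d = "det ?H powr (1 / ?n)"
  obtain A where A: "sym_pos_def A" "det A = 1" and tr: "trace (A ** ?H ** A) \<le> ?n * ?d + \<delta>"
    by (rule exists_sym_pos_def_trace_le[OF hessian_symmetric[OF op x C2] convex_hessian_psd[OF op x C2 u] assms])
  \<comment> \<open>The error over the ellipsoid is at most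
    \<open>\<eta> * (norm A * \<epsilon>)\<^sup>2\<close>, hence at most half of the allowance
    \<open>\<delta> * \<epsilon>\<^sup>2\<close>.\<close>
  define \<eta> where "\<eta> = \<delta> / 2 / ((norm A)\<^sup>2 + 1)"
  have N: "(norm A)\<^sup>2 + 1 > 0" by (smt (verit) zero_le_power2)
  have \<eta>: "\<eta> > 0" using assms N by (simp add: \<eta>_def)
  have \<eta>N: "\<eta> * (norm A)\<^sup>2 \<le> \<delta> / 2"
  proof -
    have "\<eta> * (norm A)\<^sup>2 \<le> \<eta> * ((norm A)\<^sup>2 + 1)" using \<eta> by simp
    also have "\<dots> = \<delta> / 2"
    proof -
      have "\<delta> / 2 / c * c = \<delta> / 2" if "c \<noteq> 0" for c by (simp add: that)
      moreover have "(norm A)\<^sup>2 + 1 \<noteq> 0" using N by linarith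
      ultimately show ?thesis unfolding \<eta>_def .
    qed
    finally show ?thesis .
  qed
  obtain r where r: "r > 0" "ball x r \<subseteq> \<Omega>" and ex:
    "\<And>h. norm h < r \<Longrightarrow> \<bar>central_diff u x h - (h \<bullet> (?H *v h)) / 2\<bar> \<le> \<eta> * (norm h)\<^sup>2"
    by (rule central_diff_expansion[OF op x C2 \<eta>]) blast
  have "\<forall>\<^sub>F \<epsilon> in at_right 0. \<epsilon> < r / (norm A + 1)"
    using r by (intro order_tendstoD(2)[OF tendsto_ident_at] divide_pos_pos) (auto intro: add_nonneg_pos)
  moreover have "\<forall>\<^sub>F \<epsilon> in at_right (0::real). 0 < \<epsilon>"
    by (simp add: eventually_at_right_less)
  ultimately have "\<forall>\<^sub>F \<epsilon> in at_right 0. A \<in> admissible \<Omega> \<epsilon> x \<and>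
    ellipsoid_mean u \<epsilon> A x \<le> u x + (?n / (2 * (?n + 2)) * ?d + \<delta>) * \<epsilon>\<^sup>2"
  proof eventually_elim
    case (elim \<epsilon>)
    have small: "norm A * \<epsilon> < r"
    proof -
      have "norm A * \<epsilon> \<le> (norm A + 1) * \<epsilon>" using elim by simp
      also have "\<dots> < r" using elim(1) by (simp add: pos_less_divide_eq add_nonneg_pos mult.commute)
      finally show ?thesis .
    qed
    have adm: "A \<in> admissible \<Omega> \<epsilon> x" by (rule admissibleI[OF A small r(2)])
    have "central_diff u x (A *v y) \<le> 1/2 * ((A *v y) \<bullet> (?H *v (A *v y))) + \<eta> * (norm A * \<epsilon>)\<^sup>2"
      if y: "y \<in> cball 0 \<epsilon>" for y
    proof -
      have "norm (A *v y) \<le> norm A * norm y" by (rule norm_matrix_vector_le)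
      also have "\<dots> \<le> norm A * \<epsilon>" using y by (intro mult_left_mono) auto
      finally have le: "norm (A *v y) \<le> norm A * \<epsilon>" .
      then have "\<eta> * (norm (A *v y))\<^sup>2 \<le> \<eta> * (norm A * \<epsilon>)\<^sup>2"
        using \<eta> by (intro mult_left_mono power_mono) auto
      with ex[of "A *v y"] le small show ?thesis unfolding abs_le_iff by simp
    qed
    from ellipsoid_mean_le[OF C2_on_continuous elim(2) adm this]
    have "ellipsoid_mean u \<epsilon> A x
        \<le> u x + 1/2 * \<epsilon>\<^sup>2 / (?n + 2) * trace (A ** ?H ** A) + \<eta> * (norm A * \<epsilon>)\<^sup>2" .
    also have "\<dots> \<le> u x + 1/2 * \<epsilon>\<^sup>2 / (?n + 2) * (?n * ?d + \<delta>) + (\<delta> / 2) * \<epsilon>\<^sup>2"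
    proof (intro add_mono mult_left_mono tr order_refl)
      show "\<eta> * (norm A * \<epsilon>)\<^sup>2 \<le> (\<delta> / 2) * \<epsilon>\<^sup>2"
        using mult_right_mono[OF \<eta>N, of "\<epsilon>\<^sup>2"] by (simp add: power_mult_distrib mult_ac)
    qed simp
    also have "\<dots> = u x + (?n / (2 * (?n + 2)) * ?d + (\<delta> / (2 * (?n + 2)) + \<delta> / 2)) * \<epsilon>\<^sup>2"
      by (simp add: add_divide_distrib distrib_left distrib_right mult_ac)
    also have "\<dots> \<le> u x + (?n / (2 * (?n + 2)) * ?d + \<delta>) * \<epsilon>\<^sup>2"
    proof -
      \<comment> \<open>The excess of the trace over its infimum uses the other half of the
        allowance.\<close>
      have "\<delta> / (2 * (?n + 2)) \<le> \<delta> / 2" using assms by (intro divide_left_mono) auto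
      then have "\<delta> / (2 * (?n + 2)) + \<delta> / 2 \<le> \<delta>" by linarith
      then show ?thesis by (intro add_left_mono mult_right_mono) simp_all
    qed
    finally show ?case using adm by blast
  qed
  with that show ?thesis by blast
qed

text \<open>Coercivity turns the additive Taylor error into a relative loss \<open>e\<close>, which
  makes the estimate uniform in \<open>A\<close>. Ellipsoids reaching beyond the radius
  \<open>r\<close> are handled by convexity.\<close>

lemma ellipsoid_mean_lower_bound:
  assumes e: "0 < e" "e < 1" and det: "det (hessian u x) \<noteq> 0"
  shows "\<forall>\<^sub>F \<epsilon> in at_right 0. \<forall>A\<in>admissible \<Omega> \<epsilon> x.
    u x + (1 - e) * (real CARD('n) / (2 * (real CARD('n) + 2))
      * det (hessian u x) powr (1 / real CARD('n))) * \<epsilon>\<^sup>2 \<le> ellipsoid_mean u \<epsilon> A x"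
proof -
  let ?n = "real CARD('n)" and ?H = "hessian u x"
  let ?d = "det ?H powr (1 / ?n)"
  note sym = hessian_symmetric[OF op x C2] and psd = convex_hessian_psd[OF op x C2 u]
  obtain c where c: "c > 0" and coer: "\<And>v. c * (norm v)\<^sup>2 \<le> v \<bullet> (?H *v v)"
    by (rule psd_det_nonzero_coercive[OF sym psd det]) blast
  \<comment> \<open>With this error constant, coercivity bounds the error by \<open>e / 2\<close>
    times the form.\<close>
  have \<eta>: "e * c / 2 > 0" using e c by simp
  obtain r0 where r0: "r0 > 0" and ex:
    "\<And>h. norm h < r0 \<Longrightarrow> \<bar>central_diff u x h - (h \<bullet> (?H *v h)) / 2\<bar> \<le> (e * c / 2) * (norm h)\<^sup>2"
    by (rule central_diff_expansion[OF op x C2 \<eta>]) blast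
  \<comment> \<open>Halving allows the non-strict condition \<open>norm h \<le> r\<close>.\<close>
  define r where "r = r0 / 2"
  have r: "r > 0" using r0 by (simp add: r_def)
  have low: "(1 - e) / 2 * (h \<bullet> (?H *v h)) \<le> central_diff u x h" if "norm h \<le> r" for h
  proof -
    have "(e / 2) * (c * (norm h)\<^sup>2) \<le> (e / 2) * (h \<bullet> (?H *v h))"
      using e by (intro mult_left_mono coer) auto
    with ex[of h] that r0 show ?thesis unfolding r_def abs_le_iff
      by (simp add: algebra_simps diff_divide_distrib)
  qed
  \<comment> \<open>Below this threshold
    \<open>\<epsilon>\<^sup>2 * (?n * ?d) \<le> c * r\<^sup>2\<close>, which is what eccentric
    ellipsoids need; \<open>+ 1\<close> keeps the denominator positive.\<close>
  define \<epsilon>0 where "\<epsilon>0 = sqrt (c * r\<^sup>2 / (?n * ?d + 1))"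
  have nd: "0 \<le> ?n * ?d" by simp
  then have nd1: "?n * ?d + 1 > 0" by linarith
  have "\<epsilon>0 > 0" using c r nd1 by (simp add: \<epsilon>0_def)
  then have "\<forall>\<^sub>F \<epsilon> in at_right 0. \<epsilon> < \<epsilon>0"
    by (rule order_tendstoD(2)[OF tendsto_ident_at])
  moreover have "\<forall>\<^sub>F \<epsilon> in at_right (0::real). 0 < \<epsilon>"
    by (simp add: eventually_at_right_less)
  ultimately show ?thesis
  proof eventually_elim
    case (elim \<epsilon>)
    have "\<epsilon>\<^sup>2 \<le> \<epsilon>0\<^sup>2" using elim by (intro power_mono) auto
    also have "\<epsilon>0\<^sup>2 = c * r\<^sup>2 / (?n * ?d + 1)" using c r nd1 by (simp add: \<epsilon>0_def)
    finally have "\<epsilon>\<^sup>2 * (?n * ?d + 1) \<le> c * r\<^sup>2" using nd1 by (simp add: pos_le_divide_eq)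
    moreover have "\<epsilon>\<^sup>2 * (?n * ?d + 1) = \<epsilon>\<^sup>2 * (?n * ?d) + \<epsilon>\<^sup>2" by (simp add: distrib_left)
    moreover have "0 \<le> \<epsilon>\<^sup>2" by simp
    ultimately have small: "\<epsilon>\<^sup>2 * (?n * ?d) \<le> c * r\<^sup>2" by linarith
    show ?case
    proof
      fix A assume A: "A \<in> admissible \<Omega> \<epsilon> x"
      then have symA: "transpose A = A" and detA: "det A = 1" by (auto simp: admissible_def sym_pos_def_def)
      let ?T = "trace (A ** ?H ** A)"
      let ?m = "(1 - e) * (?n / (2 * (?n + 2)) * ?d) * \<epsilon>\<^sup>2"
      have nAy: "norm (A *v y) \<le> norm A * \<epsilon>" if "y \<in> cball 0 \<epsilon>" for y
      proof -
        have "norm (A *v y) \<le> norm A * norm y" by (rule norm_matrix_vector_le)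
        also have "\<dots> \<le> norm A * \<epsilon>" using that by (intro mult_left_mono) auto
        finally show ?thesis .
      qed
      show "u x + ?m \<le> ellipsoid_mean u \<epsilon> A x"
      proof (cases "norm A * \<epsilon> \<le> r")
        case True
        have "transpose (A ** ?H ** A) = A ** ?H ** A"
          by (simp add: matrix_transpose_mul symA sym matrix_mul_assoc)
        moreover have "0 \<le> v \<bullet> ((A ** ?H ** A) *v v)" for v
          unfolding inner_symmetric_conj[OF symA] by (rule psd)
        moreover have "det (A ** ?H ** A) = det ?H" by (simp add: det_mul detA)
        ultimately have "?n * ?d \<le> ?T" using det_powr_le_trace[of "A ** ?H ** A"] by simp
        then have "(1 - e) / 2 * \<epsilon>\<^sup>2 / (?n + 2) * (?n * ?d) \<le> (1 - e) / 2 * \<epsilon>\<^sup>2 / (?n + 2) * ?T"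
          using e by (intro mult_left_mono) auto
        moreover have "?m = (1 - e) / 2 * \<epsilon>\<^sup>2 / (?n + 2) * (?n * ?d)" by simp
        moreover have "u x + (1 - e) / 2 * \<epsilon>\<^sup>2 / (?n + 2) * ?T \<le> ellipsoid_mean u \<epsilon> A x"
          using nAy True by (intro ellipsoid_mean_ge[OF C2_on_continuous elim(2) A] low) force
        ultimately show ?thesis by linarith
      next
        case False
        \<comment> \<open>Dividing by \<open>t\<close> brings every displacement
          \<open>A *v y\<close> back within the radius \<open>r\<close>.\<close>
        define t where "t = norm A * \<epsilon> / r"
        have t: "t > 1" using False r by (simp add: t_def)
        have tr: "t * r = norm A * \<epsilon>" using r by (simp add: t_def)
        \<comment> \<open>Rescaling divides the form by \<open>t\<^sup>2\<close>; convexity returns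
          one factor \<open>t\<close>.\<close>
        have "(1 - e) / (2 * t) * ((A *v y) \<bullet> (?H *v (A *v y))) \<le> central_diff u x (A *v y)"
          if y: "y \<in> cball 0 \<epsilon>" for y
        proof -
          let ?h = "A *v y"
          have "norm (?h /\<^sub>R t) \<le> r"
            using nAy[OF y] t tr by (simp add: pos_divide_le_eq mult.commute flip: divide_inverse_commute)
          moreover have "(?h /\<^sub>R t) \<bullet> (?H *v (?h /\<^sub>R t)) = (?h \<bullet> (?H *v ?h)) / t\<^sup>2"
            by (simp add: matrix_vector_mult_scaleR power2_eq_square inverse_eq_divide)
          ultimately have "(1 - e) / 2 * ((?h \<bullet> (?H *v ?h)) / t\<^sup>2) \<le> central_diff u x (?h /\<^sub>R t)"
            using low by metis
          then have "t * ((1 - e) / 2 * ((?h \<bullet> (?H *v ?h)) / t\<^sup>2)) \<le> t * central_diff u x (?h /\<^sub>R t)"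
            using t by (intro mult_left_mono) auto
          also have "\<dots> \<le> central_diff u x ?h"
            using t by (intro central_diff_scale[OF u x] admissible_mem[OF A y]) auto
          finally show ?thesis using t by (simp add: power2_eq_square)
        qed
        from ellipsoid_mean_ge[OF C2_on_continuous elim(2) A this]
        have "u x + (1 - e) / (2 * t) * \<epsilon>\<^sup>2 / (?n + 2) * ?T \<le> ellipsoid_mean u \<epsilon> A x" .
        moreover have "?m \<le> (1 - e) / (2 * t) * \<epsilon>\<^sup>2 / (?n + 2) * ?T"
        proof -
          \<comment> \<open>Since \<open>norm A * \<epsilon> = t * r\<close>, coercivity makes
            \<open>\<epsilon>\<^sup>2 * ?T\<close> at least
            \<open>c * r\<^sup>2 * t\<^sup>2\<close>, enough to absorb the lost factor
            \<open>t\<close>.\<close>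
          have "\<epsilon>\<^sup>2 * (?n * ?d) * t \<le> c * r\<^sup>2 * t" using small t by (intro mult_right_mono) auto
          also have "\<dots> \<le> c * r\<^sup>2 * t * t"
            using t c mult_left_mono[of 1 t "c * r\<^sup>2 * t"] by simp
          also have "\<dots> = c * (t * r)\<^sup>2" by (simp add: power2_eq_square mult_ac)
          also have "\<dots> = \<epsilon>\<^sup>2 * (c * (norm A)\<^sup>2)" unfolding tr by (simp add: power_mult_distrib mult_ac)
          also have "\<dots> \<le> \<epsilon>\<^sup>2 * ?T" by (intro mult_left_mono trace_symmetric_conj_ge[OF symA coer]) auto
          finally have "\<epsilon>\<^sup>2 * (?n * ?d) \<le> \<epsilon>\<^sup>2 * ?T / t" using t by (simp add: pos_le_divide_eq)
          then have "(1 - e) / (2 * (?n + 2)) * (\<epsilon>\<^sup>2 * (?n * ?d)) \<le> (1 - e) / (2 * (?n + 2)) * (\<epsilon>\<^sup>2 * ?T / t)"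
            using e by (intro mult_left_mono) auto
          then show ?thesis by (simp add: mult_ac)
        qed
        ultimately show ?thesis by linarith
      qed
    qed
  qed
qed

end

theorem theorem1p3:
  fixes \<Omega> :: "(real^'n) set" and u :: "real^'n \<Rightarrow> real"
  assumes "open \<Omega>" and "convex \<Omega>"
    and "convex_on \<Omega> u" and "C2_on u \<Omega>"
  shows "\<forall>x\<in>\<Omega>.
    (\<lambda>\<epsilon>. u x - ((INF A\<in>admissible \<Omega> \<epsilon> x. ellipsoid_mean u \<epsilon> A x)
        - real CARD('n) / (2 * (real CARD('n) + 2))
            * (det (hessian u x)) powr (1 / real CARD('n)) * \<epsilon>\<^sup>2))
      \<in> o[at_right 0](\<lambda>\<epsilon>. \<epsilon>\<^sup>2)"
proof
  fix x assume x: "x \<in> \<Omega>"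
  let ?I = "\<lambda>\<epsilon>. INF A\<in>admissible \<Omega> \<epsilon> x. ellipsoid_mean u \<epsilon> A x"
  define b where "b = real CARD('n) / (2 * (real CARD('n) + 2)) * det (hessian u x) powr (1 / real CARD('n))"
  have b: "b \<ge> 0" by (simp add: b_def)
  have pos: "\<forall>\<^sub>F \<epsilon> in at_right (0::real). 0 < \<epsilon>" by (simp add: eventually_at_right_less)
  note center = ellipsoid_mean_ge_center[OF assms(1,3,4) x]
  \<comment> \<open>For each \<open>k\<close> the infimum is squeezed between
    \<open>u x + (b - k) * \<epsilon>\<^sup>2\<close> and
    \<open>u x + (b + k) * \<epsilon>\<^sup>2\<close>.\<close>
  have "\<forall>\<^sub>F \<epsilon> in at_right 0. norm (u x - (?I \<epsilon> - b * \<epsilon>\<^sup>2)) \<le> k * norm (\<epsilon>\<^sup>2)" if k: "k > 0" for k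
  proof -
    obtain A where A: "\<forall>\<^sub>F \<epsilon> in at_right 0. A \<in> admissible \<Omega> \<epsilon> x \<and>
      ellipsoid_mean u \<epsilon> A x \<le> u x + (b + k) * \<epsilon>\<^sup>2"
      unfolding b_def by (rule ellipsoid_mean_near_optimal[OF assms(1,3,4) x k])
    have lower: "\<forall>\<^sub>F \<epsilon> in at_right 0. \<forall>A\<in>admissible \<Omega> \<epsilon> x. u x + (b - k) * \<epsilon>\<^sup>2 \<le> ellipsoid_mean u \<epsilon> A x"
    proof (cases "det (hessian u x) = 0")
      \<comment> \<open>There is no coercivity here, but \<open>0 powr a = 0\<close> gives
        \<open>b = 0\<close>, and \<open>u x\<close> is a lower bound by convexity.\<close>
      case True
      then have "b = 0" by (simp add: b_def)
      from pos show ?thesis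
      proof eventually_elim
        case (elim \<epsilon>)
        have "(b - k) * \<epsilon>\<^sup>2 \<le> 0" using \<open>b = 0\<close> k by simp
        with center[OF elim] show ?case by force
      qed
    next
      case False
      \<comment> \<open>Converts the relative loss into an additive one:
        \<open>e * b \<le> k\<close>. The 1/2 ensures \<open>e < 1\<close>, and \<open>b + 1\<close>
        avoids division by zero.\<close>
      define e where "e = min (1/2) (k / (b + 1))"
      have e: "0 < e" "e < 1" using k b by (auto simp: e_def)
      have "e * b \<le> k / (b + 1) * (b + 1)" using b k by (intro mult_mono) (auto simp: e_def)
      also have "\<dots> = k" using b by simp
      finally have "b - k \<le> (1 - e) * b" by (simp add: algebra_simps)
      then have le: "(b - k) * \<epsilon>\<^sup>2 \<le> (1 - e) * b * \<epsilon>\<^sup>2" for \<epsilon> by (rule mult_right_mono) simp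
      from ellipsoid_mean_lower_bound[OF assms(1,3,4) x e False, folded b_def] show ?thesis
      proof eventually_elim
        case (elim \<epsilon>)
        show ?case
        proof
          fix A assume "A \<in> admissible \<Omega> \<epsilon> x"
          with elim have "u x + (1 - e) * b * \<epsilon>\<^sup>2 \<le> ellipsoid_mean u \<epsilon> A x" by blast
          with le[of \<epsilon>] show "u x + (b - k) * \<epsilon>\<^sup>2 \<le> ellipsoid_mean u \<epsilon> A x" by linarith
        qed
      qed
    qed
    from A lower pos show ?thesis
    proof eventually_elim
      case (elim \<epsilon>)
      \<comment> \<open>A real infimum is meaningful only over a nonempty set bounded below:
        \<open>A\<close> provides nonemptiness, \<open>u x\<close> the bound.\<close>
      have "?I \<epsilon> \<le> ellipsoid_mean u \<epsilon> A x"
        using elim center by (intro cINF_lower) (auto intro!: bdd_belowI2)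
      moreover have "u x + (b - k) * \<epsilon>\<^sup>2 \<le> ?I \<epsilon>"
        using elim by (intro cINF_greatest) auto
      ultimately show ?case using elim(1) by (auto simp: algebra_simps abs_le_iff)
    qed
  qed
  then show "(\<lambda>\<epsilon>. u x - (?I \<epsilon> - real CARD('n) / (2 * (real CARD('n) + 2))
      * det (hessian u x) powr (1 / real CARD('n)) * \<epsilon>\<^sup>2)) \<in> o[at_right 0](\<lambda>\<epsilon>. \<epsilon>\<^sup>2)"
    unfolding b_def by (rule landau_o.smallI)
qed

end
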